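(* Let $G$ be a simple grid graph. For each integer $k\ge 1$ let $G^k=\{v\in V(G)\mid d_v=k\}$. Then $$\ln(\tau(G))\leq\sum_{k\geq 2} \ln(F(k))\cdot|G^k|.$$
   Context: $\tau(G)$ is the number of spanning trees of a finite connected graph $G$, and $V(G)$ is its vertex set. $\mathcal{L}(\mathbb{Z}^2)$ is the regular square lattice graph: its vertex set is $\mathbb{Z}^2$ and its edges join points at Euclidean distance $1$. A grid graph is a finite connected subgraph of $\mathcal{L}(\mathbb{Z}^2)$. A simple closed loop in $\mathcal{L}(\mathbb{Z}^2)$ is a sequence $\alpha$ of more than two distinct vertices in which each successive pair (including the pair consisting of the first and the last) is an edge of $\mathcal{L}(\mathbb{Z}^2)$. A grid graph $G$ is simple if it consists of all of the vertices and edges of $\mathcal{L}(\mathbb{Z}^2)$ that are on and interior to a simple closed loop. The words-on-a-page ordering of vertices lists rows from top (largest $y$) to bottom, each row ordered left to right. For $v\in V(G)$, $H_v$ is the subgraph of $G$ induced by all vertices of $G$ prior to and including $v$ in this ordering. $\mathcal{U}$ is the infinite subgraph of $\mathcal{L}(\mathbb{Z}^2)$ induced by the vertex set $\{(x,y)\in\mathbb{Z}^2\mid y\geq 1\text{ or }(y=0\text{ and } x\leq 0)\}$. For $k\ge 1$, $\tilde{\mathcal{U}}(k)$ is the subgraph of $\mathcal{U}$ induced by all vertices at edge distance (in $\mathcal{U}$) at most $k$ from $\mathbf{0}=(0,0)$, and $\mathcal{U}(k)$ is obtained from $\tilde{\mathcal{U}}(k)$ by removing all vertices that have degree $1$ in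 $\tilde{\mathcal{U}}(k)$, together with their adjacent edges. For a vertex $v$ of a grid graph $G$, $d_v=\max\{k\ge 1\mid \mathcal{U}(k)\subset H_v\}$, where $H_v$ is first translated so that $v=\mathbf{0}$ (equivalently, the translate of $\mathcal{U}(k)$ by $v$ is a subgraph of $H_v$). For $k\ge 2$, $E(k)$ is the probability that a simple random walk on $\mathcal{U}(k)$ starting at $(0,0)$ reaches $(-1,0)$ before returning to $(0,0)$, and $F(k)=\frac{2E(k)}{2E(k)-1}$. *)

theory Defs
  imports "HOL-Probability.Probability"
begin

section \<open>Undirected simple graphs\<close>

record 'a ugraph =
  verts :: "'a set"
  edges :: "'a set set"

definition wf_ugraph :: "'a ugraph \<Rightarrow> bool" where
  "wf_ugraph G \<longleftrightarrow> (\<forall>e\<in>edges G. \<exists>u\<in>verts G. \<exists>v\<in>verts G. u \<noteq> v \<and> e = {u, v})"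

definition adj :: "'a ugraph \<Rightarrow> 'a \<Rightarrow> 'a \<Rightarrow> bool" where
  "adj G u v \<longleftrightarrow> {u, v} \<in> edges G"

definition neighbours :: "'a ugraph \<Rightarrow> 'a \<Rightarrow> 'a set" where
  "neighbours G v = {w. adj G v w}"

definition vertex_degree :: "'a ugraph \<Rightarrow> 'a \<Rightarrow> nat" where
  "vertex_degree G v = card (neighbours G v)"

definition subgraph :: "'a ugraph \<Rightarrow> 'a ugraph \<Rightarrow> bool" where
  "subgraph H G \<longleftrightarrow> wf_ugraph H \<and> verts H \<subseteq> verts G \<and> edges H \<subseteq> edges G"

definition induced_subgraph :: "'a ugraph \<Rightarrow> 'a set \<Rightarrow> 'a ugraph" where
  "induced_subgraph G W = \<lparr>verts = verts G \<inter> W, edges = {e \<in> edges G. e \<subseteq> W}\<rparr>"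

definition map_ugraph :: "('a \<Rightarrow> 'b) \<Rightarrow> 'a ugraph \<Rightarrow> 'b ugraph" where
  "map_ugraph f G = \<lparr>verts = f ` verts G, edges = (\<lambda>e. f ` e) ` edges G\<rparr>"

text \<open>A walk is given by the list of its vertices, one more than it has steps.\<close>

definition walk :: "'a ugraph \<Rightarrow> 'a \<Rightarrow> 'a list \<Rightarrow> 'a \<Rightarrow> bool" where
  "walk G u p v \<longleftrightarrow> p \<noteq> [] \<and> set p \<subseteq> verts G \<and> hd p = u \<and> last p = v \<and> successively (adj G) p"

definition edge_distance :: "'a ugraph \<Rightarrow> 'a \<Rightarrow> 'a \<Rightarrow> enat" where
  "edge_distance G u v = (INF p\<in>{p. walk G u p v}. enat (length p - 1))"

definition connected_graph :: "'a ugraph \<Rightarrow> bool" where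
  "connected_graph G \<longleftrightarrow> verts G \<noteq> {} \<and> (\<forall>u\<in>verts G. \<forall>v\<in>verts G. \<exists>p. walk G u p v)"

definition simple_closed_loop :: "'a ugraph \<Rightarrow> 'a list \<Rightarrow> bool" where
  "simple_closed_loop G \<alpha> \<longleftrightarrow> length \<alpha> > 2 \<and> distinct \<alpha> \<and> set \<alpha> \<subseteq> verts G \<and>
     successively (adj G) \<alpha> \<and> adj G (last \<alpha>) (hd \<alpha>)"

definition is_tree :: "'a ugraph \<Rightarrow> bool" where
  "is_tree T \<longleftrightarrow> connected_graph T \<and> \<not> (\<exists>\<alpha>. simple_closed_loop T \<alpha>)"

definition spanning_tree :: "'a ugraph \<Rightarrow> 'a ugraph \<Rightarrow> bool" where
  "spanning_tree T G \<longleftrightarrow> subgraph T G \<and> verts T = verts G \<and> is_tree T"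

definition num_spanning_trees :: "'a ugraph \<Rightarrow> nat" where
  "num_spanning_trees G = card {T. spanning_tree T G}"

section \<open>Simple grid graphs\<close>

type_synonym point = "int \<times> int"

text \<open>
  The plane is represented by the complex numbers, the setting of the Jordan curve theorem in
  the library.
\<close>

definition plane :: "point \<Rightarrow> complex" where
  "plane v = Complex (of_int (fst v)) (of_int (snd v))"

definition square_lattice :: "point ugraph" where
  "square_lattice = \<lparr>verts = UNIV, edges = {{u, v} | u v. dist (plane u) (plane v) = 1}\<rparr>"

definition grid_graph :: "point ugraph \<Rightarrow> bool" where
  "grid_graph G \<longleftrightarrow> finite (verts G) \<and> connected_graph G \<and> subgraph G square_lattice"

definition loop_curve :: "point list \<Rightarrow> complex set" where
  "loop_curve \<alpha> = (\<Union>i<length \<alpha>.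
     closed_segment (plane (\<alpha> ! i)) (plane (\<alpha> ! (Suc i mod length \<alpha>))))"

definition loop_region :: "point list \<Rightarrow> complex set" where
  "loop_region \<alpha> = loop_curve \<alpha> \<union> inside (loop_curve \<alpha>)"

definition enclosed_graph :: "point list \<Rightarrow> point ugraph" where
  "enclosed_graph \<alpha> =
     \<lparr>verts = {v. plane v \<in> loop_region \<alpha>},
      edges = {{u, v} | u v. adj square_lattice u v \<and>
                 closed_segment (plane u) (plane v) \<subseteq> loop_region \<alpha>}\<rparr>"

definition simple_grid_graph :: "point ugraph \<Rightarrow> bool" where
  "simple_grid_graph G \<longleftrightarrow> grid_graph G \<and>
     (\<exists>\<alpha>. simple_closed_loop square_lattice \<alpha> \<and> G = enclosed_graph \<alpha>)"

section \<open>The graphs \<open>H\<^sub>v\<close> and \<open>U(k)\<close>, and the depth \<open>d\<^sub>v\<close>\<close>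

definition page_le :: "point \<Rightarrow> point \<Rightarrow> bool" where
  "page_le u v \<longleftrightarrow> snd u > snd v \<or> (snd u = snd v \<and> fst u \<le> fst v)"

definition Hgraph :: "point ugraph \<Rightarrow> point \<Rightarrow> point ugraph" where
  "Hgraph G v = induced_subgraph G {u. page_le u v}"

definition Uinf :: "point ugraph" where
  "Uinf = induced_subgraph square_lattice {(x, y). y \<ge> 1 \<or> (y = 0 \<and> x \<le> 0)}"

definition Utilde :: "nat \<Rightarrow> point ugraph" where
  "Utilde k = induced_subgraph Uinf {v. edge_distance Uinf (0, 0) v \<le> enat k}"

definition Ugraph :: "nat \<Rightarrow> point ugraph" where
  "Ugraph k = induced_subgraph (Utilde k) {v. vertex_degree (Utilde k) v \<noteq> 1}"

definition translate_graph :: "point \<Rightarrow> point ugraph \<Rightarrow> point ugraph" where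
  "translate_graph v = map_ugraph (\<lambda>u. u + v)"

definition depth :: "point ugraph \<Rightarrow> point \<Rightarrow> nat" where
  "depth G v = Max {k. k \<ge> 1 \<and> subgraph (translate_graph v (Ugraph k)) (Hgraph G v)}"

definition depth_class :: "point ugraph \<Rightarrow> nat \<Rightarrow> point set" where
  "depth_class G k = {v \<in> verts G. depth G v = k}"

section \<open>Simple random walk\<close>

text \<open>
  The conditional law of the position at time \<open>n\<close> given the earlier positions: the walk starts
  at \<open>v\<close> and moves to a uniformly chosen neighbour of its current position.  The law of
  the whole trajectory is the infinite product of these kernels (Ionescu-Tulcea).
\<close>

definition srw_kernel :: "'a ugraph \<Rightarrow> 'a \<Rightarrow> nat \<Rightarrow> (nat \<Rightarrow> 'a) \<Rightarrow> 'a measure" where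
  "srw_kernel G v n \<omega> =
     (case n of 0 \<Rightarrow> measure_pmf (return_pmf v)
      | Suc m \<Rightarrow> measure_pmf (pmf_of_set (neighbours G (\<omega> m))))"

lemma Ionescu_Tulcea_srw_kernel:
  "Ionescu_Tulcea (srw_kernel G v) (\<lambda>_. count_space UNIV)"
proof (rule Ionescu_Tulcea.intro)
  show "srw_kernel G v i \<in>
      measurable (PiM {0..<i} (\<lambda>_. count_space UNIV)) (subprob_algebra (count_space UNIV))" for i
  proof (cases i)
    case 0
    then show ?thesis
      by (auto simp: srw_kernel_def[abs_def] measure_pmf_in_subprob_space)
  next
    case (Suc m)
    have "(\<lambda>x. measure_pmf (pmf_of_set (neighbours G x))) \<in>
        measurable (count_space UNIV) (subprob_algebra (count_space UNIV))"
      by (auto simp: measure_pmf_in_subprob_space)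
    moreover have "(\<lambda>\<omega>. \<omega> m) \<in> measurable (PiM {0..<i} (\<lambda>_. count_space UNIV)) (count_space UNIV)"
      using Suc by (intro measurable_component_singleton) auto
    ultimately show ?thesis
      unfolding srw_kernel_def[abs_def] Suc nat.case by (rule measurable_compose[rotated])
  qed
  show "prob_space (srw_kernel G v i x)"
    if "x \<in> space (PiM {0..<i} (\<lambda>_. count_space UNIV))" for i x
    by (cases i) (auto simp: srw_kernel_def intro: measure_pmf.prob_space_axioms)
qed

definition srw :: "'a ugraph \<Rightarrow> 'a \<Rightarrow> (nat \<Rightarrow> 'a) measure" where
  "srw G v = projective_family.lim UNIV
     (Ionescu_Tulcea.CI (srw_kernel G v) (\<lambda>_. count_space UNIV)) (\<lambda>_. count_space UNIV)"

definition Eprob :: "nat \<Rightarrow> real" where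
  "Eprob k = measure (srw (Ugraph k) (0, 0))
     {\<omega>. \<exists>n\<ge>1. \<omega> n = (-1, 0) \<and> (\<forall>m. 1 \<le> m \<and> m < n \<longrightarrow> \<omega> m \<noteq> (0, 0))}"

definition Fval :: "nat \<Rightarrow> real" where
  "Fval k = 2 * Eprob k / (2 * Eprob k - 1)"

end

theory Submission
  imports Defs
begin

text \<open>
  Build \<open>G\<close> one vertex at a time in the words-on-a-page order and watch the number of spanning
  trees.  A new vertex \<open>v\<close> has at most two earlier neighbours, the one to its left and the one
  above.  If at most one of its edges is present, or if its two edges do not close a cycle, the
  number does not grow.  If they close a cycle, that cycle and its interior lie in the simply
  connected region of \<open>G\<close>, and \<open>v\<close> is a corner of it, so the unit square to the upper left of
  \<open>v\<close> belongs to \<open>G\<close> and \<open>d\<^sub>v \<ge> 2\<close>.  It then remains to see that the number grows at most by the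
  factor \<open>F(d\<^sub>v)\<close>; the product over all vertices, after taking logarithms, is the claim.

  For the factor, let \<open>e\<close> be the edge from \<open>v\<close> to its left neighbour and let \<open>p\<close> be the proportion
  of spanning trees of \<open>H\<^sub>v\<close> that contain \<open>e\<close>.  Deleting \<open>e\<close> makes \<open>v\<close> a leaf, so the growth factor
  is \<open>1 / (1 - p)\<close>.  By Kirchhoff, \<open>1 / p\<close> is the effective conductance between the ends of \<open>e\<close>
  (lemma \<open>tree_voltage\<close>: counting trees by the direction in which their path crosses an edge gives
  a function that is harmonic off the ends).  By Rayleigh monotonicity (lemma \<open>rayleigh\<close>, from the
  Dirichlet principle) this conductance is at least that of \<open>U(k)\<close>, because a translate of \<open>U(k)\<close>,
  with \<open>k = d\<^sub>v\<close>, lies in \<open>H\<^sub>v\<close>.  In \<open>U(k)\<close> the origin has degree 2, and comparing the walk with the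
  voltage (lemma \<open>hit_prob_le_voltage\<close>) shows that its conductance is at least \<open>2 E(k)\<close>.  Hence
  \<open>1 / p \<ge> 2 E(k)\<close>, and since \<open>2 E(k) > 1\<close> (lemma \<open>Eprob_gt_half\<close>) this rearranges to
  \<open>1 / (1 - p) \<le> F(k)\<close>; this is lemma \<open>Fval_bound\<close>.

  The graphs \<open>H\<^sub>v\<close> need not be connected.  For this reason all counting is done with maximal
  spanning forests, the bases of the graphic matroid, which for a connected graph are the spanning
  trees.
\<close>

section \<open>Connectivity, forests and their exchange property\<close>

text \<open>
  Ordered pairs, so that sums over oriented edges and reachability can be expressed directly.
\<close>
definition arcs :: "'a set set \<Rightarrow> ('a \<times> 'a) set" where
  "arcs F = {(u, v). {u, v} \<in> F}"

definition conn :: "'a set set \<Rightarrow> ('a \<times> 'a) set" where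
  "conn F = (arcs F)\<^sup>*"

text \<open>
  Acyclicity without cycles: no edge can be bypassed.  This form is the one that exchange arguments use.
\<close>
definition forest :: "'a set set \<Rightarrow> bool" where
  "forest F \<longleftrightarrow> (\<forall>u v. {u, v} \<in> F \<longrightarrow> (u, v) \<notin> conn (F - {{u, v}}))"

text \<open>
  The maximal spanning forests of the edge set: the bases of its graphic matroid.
\<close>
definition bases :: "'a set set \<Rightarrow> 'a set set set" where
  "bases E = {B. B \<subseteq> E \<and> forest B \<and> arcs E \<subseteq> conn B}"

definition edge_set :: "'a set set \<Rightarrow> bool" where
  "edge_set E \<longleftrightarrow> finite E \<and> (\<forall>e\<in>E. \<exists>u v. u \<noteq> v \<and> e = {u, v})"

lemma arcs_iff [simp]: "(u, v) \<in> arcs F \<longleftrightarrow> {u, v} \<in> F"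
  by (simp add: arcs_def)

lemma conn_refl [simp]: "(u, u) \<in> conn F"
  by (simp add: conn_def)

lemma conn_edge: "{u, v} \<in> F \<Longrightarrow> (u, v) \<in> conn F"
  by (simp add: conn_def r_into_rtrancl)

lemma conn_trans: "(u, v) \<in> conn F \<Longrightarrow> (v, w) \<in> conn F \<Longrightarrow> (u, w) \<in> conn F"
  by (simp add: conn_def)

lemma conn_sym: "(u, v) \<in> conn F \<longleftrightarrow> (v, u) \<in> conn F"
proof -
  have "sym (arcs F)" by (auto simp: sym_def insert_commute)
  then show ?thesis unfolding conn_def by (meson sym_rtrancl symD)
qed

lemma conn_symD: "(u, v) \<in> conn F \<Longrightarrow> (v, u) \<in> conn F"
  by (simp add: conn_sym)

lemma conn_mono: "F \<subseteq> F' \<Longrightarrow> conn F \<subseteq> conn F'"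
  unfolding conn_def by (rule rtrancl_mono) auto

lemma conn_monoD: "(u, v) \<in> conn F \<Longrightarrow> F \<subseteq> F' \<Longrightarrow> (u, v) \<in> conn F'"
  using conn_mono by blast

lemma conn_absorb: "arcs F \<subseteq> conn F' \<Longrightarrow> conn F \<subseteq> conn F'"
  unfolding conn_def by (metis rtrancl_subset_rtrancl)

text \<open>
  A walk that uses the new edge has a part before its first and a part after its last use of it.
\<close>
lemma conn_insert:
  assumes "(u, w) \<in> conn (insert {x, y} F)"
  shows "(u, w) \<in> conn F \<or> (u, x) \<in> conn F \<and> (y, w) \<in> conn F \<or> (u, y) \<in> conn F \<and> (x, w) \<in> conn F"
  using assms unfolding conn_def[of "insert _ _"]
proof (induction rule: rtrancl_induct)
  case base
  then show ?case by simp
next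
  case (step w w')
  have "{w, w'} \<in> F \<or> w = x \<and> w' = y \<or> w = y \<and> w' = x"
    using step.hyps by (auto simp: doubleton_eq_iff)
  then show ?case
  proof (elim disjE)
    assume "{w, w'} \<in> F"
    then show ?thesis using step.IH conn_edge conn_trans by metis
  next
    assume "w = x \<and> w' = y"
    then show ?thesis using step.IH conn_trans conn_sym conn_refl by metis
  next
    assume "w = y \<and> w' = x"
    then show ?thesis using step.IH conn_trans conn_sym conn_refl by metis
  qed
qed

text \<open>
  A walk that never meets the vertex \<open>x\<close> never uses an edge at \<open>x\<close>.
\<close>
lemma conn_remove:
  assumes "(u, w) \<in> conn F" "(u, x) \<notin> conn F"
  shows "(u, w) \<in> conn (F - {{x, y}})"
  using assms(1) unfolding conn_def[of F]
proof (induction rule: rtrancl_induct)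
  case base
  then show ?case by simp
next
  case (step w w')
  have uw: "(u, w) \<in> conn F" "(u, w') \<in> conn F"
    using step.hyps by (simp_all add: conn_def rtrancl_into_rtrancl)
  then have "w \<noteq> x" "w' \<noteq> x" using assms(2) by auto
  then have "{w, w'} \<in> F - {{x, y}}" using step.hyps by (auto simp: doubleton_eq_iff)
  then show ?case using step.IH conn_edge conn_trans by metis
qed

text \<open>
  The edge by which a walk reaches \<open>x\<close> for the first time: up to there no edge at \<open>x\<close> has been used.
\<close>
lemma conn_last_edge:
  assumes "(u, x) \<in> conn F" "u \<noteq> x"
  obtains z where "{z, x} \<in> F" "(u, z) \<in> conn (F - {{z, x}})"
proof -
  \<comment> \<open>edges away from \<open>x\<close>\<close>
  define F0 where "F0 = {e \<in> F. x \<notin> e}"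
  have stuck: "w \<noteq> x" if "(u, w) \<in> conn F0" for w
    using that unfolding conn_def
    by (induction rule: rtrancl_induct) (use assms(2) in \<open>auto simp: F0_def\<close>)
  have "(\<exists>z. {z, x} \<in> F \<and> (u, z) \<in> conn F0) \<or> (u, w) \<in> conn F0" if "(u, w) \<in> conn F" for w
    using that unfolding conn_def[of F]
  proof (induction rule: rtrancl_induct)
    case base
    then show ?case by simp
  next
    case (step w w')
    show ?case
    proof (cases "\<exists>z. {z, x} \<in> F \<and> (u, z) \<in> conn F0")
      case False
      then have w: "(u, w) \<in> conn F0" using step.IH by blast
      have "w' \<noteq> x" using False w step.hyps by auto
      then have "{w, w'} \<in> F0" using step.hyps stuck[OF w] by (auto simp: F0_def)
      then show ?thesis using w conn_edge conn_trans by metis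
    qed simp
  qed
  from this[OF assms(1)] obtain z where z: "{z, x} \<in> F" "(u, z) \<in> conn F0"
    using stuck by blast
  moreover have "F0 \<subseteq> F - {{z, x}}" by (auto simp: F0_def)
  ultimately show thesis using that conn_monoD by metis
qed

lemma forestD: "forest F \<Longrightarrow> {u, v} \<in> F \<Longrightarrow> (u, v) \<notin> conn (F - {{u, v}})"
  by (simp add: forest_def)

lemma forest_subset:
  assumes "forest F" "F' \<subseteq> F"
  shows "forest F'"
  unfolding forest_def
proof (intro allI impI notI)
  fix u v
  assume uv: "{u, v} \<in> F'" and c: "(u, v) \<in> conn (F' - {{u, v}})"
  have "(u, v) \<in> conn (F - {{u, v}})" by (rule conn_monoD[OF c]) (use assms(2) in auto)
  moreover have "{u, v} \<in> F" using uv assms(2) by auto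
  ultimately show False using forestD[OF assms(1), of u v] by simp
qed

lemma forest_insert:
  assumes "forest F" "(x, y) \<notin> conn F"
  shows "forest (insert {x, y} F)"
  unfolding forest_def
proof (intro allI impI notI)
  fix u v
  assume uv: "{u, v} \<in> insert {x, y} F" and c: "(u, v) \<in> conn (insert {x, y} F - {{u, v}})"
  have xyF: "{x, y} \<notin> F" using assms(2) conn_edge by metis
  show False
  proof (cases "{u, v} = {x, y}")
    case True
    then have "(u, v) \<in> conn F" using c xyF by simp
    then have "(x, y) \<in> conn F" using True conn_symD[of u v F] by (auto simp: doubleton_eq_iff)
    then show False using assms(2) by simp
  next
    case False
    then have uvF: "{u, v} \<in> F" using uv by simp
    let ?F = "F - {{u, v}}"
    have sub: "?F \<subseteq> F" by auto
    have "insert {x, y} F - {{u, v}} = insert {x, y} ?F" using False by auto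
    then have "(u, v) \<in> conn (insert {x, y} ?F)" using c by simp
    moreover have "(u, v) \<notin> conn ?F" using forestD[OF assms(1) uvF] .
    ultimately consider "(u, x) \<in> conn ?F" "(y, v) \<in> conn ?F"
      | "(u, y) \<in> conn ?F" "(x, v) \<in> conn ?F"
      using conn_insert[of u v x y ?F] by blast
    then have "(x, y) \<in> conn F"
    proof cases
      case 1
      show ?thesis
        by (rule conn_trans[OF conn_symD[OF conn_monoD[OF 1(1) sub]]
              conn_trans[OF conn_edge[OF uvF] conn_symD[OF conn_monoD[OF 1(2) sub]]]])
    next
      case 2
      show ?thesis
        by (rule conn_trans[OF conn_monoD[OF 2(2) sub]
              conn_trans[OF conn_symD[OF conn_edge[OF uvF]] conn_monoD[OF 2(1) sub]]])
    qed
    then show False using assms(2) by simp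
  qed
qed

lemma basesD:
  assumes "B \<in> bases E"
  shows "B \<subseteq> E" "forest B" "arcs E \<subseteq> conn B" "conn E \<subseteq> conn B"
  using assms conn_absorb unfolding bases_def by auto

lemma finite_bases: "finite E \<Longrightarrow> finite (bases E)"
  by (rule finite_subset[of _ "Pow E"]) (auto simp: bases_def)

lemma forest_extends:
  assumes "finite E" "forest F" "F \<subseteq> E"
  obtains B where "B \<in> bases E" "F \<subseteq> B"
proof -
  define P where "P = {F'. F \<subseteq> F' \<and> F' \<subseteq> E \<and> forest F'}"
  have "finite P" using assms(1) by (auto simp: P_def intro: finite_subset[of _ "Pow E"])
  moreover have "F \<in> P" using assms by (simp add: P_def)
  ultimately obtain B where B: "B \<in> P" and max: "\<And>F'. F' \<in> P \<Longrightarrow> B \<subseteq> F' \<Longrightarrow> B = F'"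
    using finite_has_maximal[of P] by blast
  have "(u, v) \<in> conn B" if "{u, v} \<in> E" for u v
  proof (rule ccontr)
    assume n: "(u, v) \<notin> conn B"
    then have "insert {u, v} B \<in> P" using B that forest_insert[of B] by (auto simp: P_def)
    from max[OF this] have "{u, v} \<in> B" by auto
    then show False using n conn_edge by metis
  qed
  then have "arcs E \<subseteq> conn B" by (auto simp: arcs_def)
  then have "B \<in> bases E" "F \<subseteq> B" using B by (auto simp: P_def bases_def)
  then show thesis by (rule that)
qed

text \<open>
  Removing an edge of a basis splits one of its trees in two; any other edge that joins the two parts
  repairs the basis.  The second conclusion says that this edge joins different parts.
\<close>
lemma bases_exchange:
  assumes B: "B \<in> bases E" and ab: "{a, b} \<in> B" and xy: "{x, y} \<in> E"
    and c: "(a, x) \<in> conn (B - {{a, b}})" "(y, b) \<in> conn (B - {{a, b}})"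
  shows "insert {x, y} (B - {{a, b}}) \<in> bases E" "(x, y) \<notin> conn (B - {{a, b}})"
proof -
  let ?F = "B - {{a, b}}"
  let ?B = "insert {x, y} ?F"
  have nab: "(a, b) \<notin> conn ?F" by (rule forestD[OF basesD(2)[OF B] ab])
  show n: "(x, y) \<notin> conn ?F"
  proof
    assume "(x, y) \<in> conn ?F"
    with nab show False using conn_trans[OF c(1) conn_trans[OF _ c(2)]] by blast
  qed
  have f: "forest ?B"
    by (rule forest_insert[OF forest_subset[OF basesD(2)[OF B]] n]) auto
  have FB: "?F \<subseteq> ?B" by auto
  have xyB: "(x, y) \<in> conn ?B" by (rule conn_edge) simp
  have abB: "(a, b) \<in> conn ?B"
    by (rule conn_trans[OF conn_monoD[OF c(1) FB] conn_trans[OF xyB conn_monoD[OF c(2) FB]]])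
  have "(u, v) \<in> conn ?B" if "{u, v} \<in> B" for u v
  proof (cases "{u, v} = {a, b}")
    case True
    then show ?thesis using abB conn_symD[OF abB] by (auto simp: doubleton_eq_iff)
  next
    case False
    then show ?thesis using that by (intro conn_edge) auto
  qed
  then have "conn B \<subseteq> conn ?B" by (intro conn_absorb) (auto simp: arcs_def)
  then have "arcs E \<subseteq> conn ?B" using basesD(3)[OF B] by (rule subset_trans[rotated])
  moreover have "?B \<subseteq> E" using basesD(1)[OF B] xy by auto
  ultimately show "?B \<in> bases E" using f by (simp add: bases_def)
qed

lemma edge_in_some_basis:
  assumes "finite E" "{a, b} \<in> E" "a \<noteq> b"
  obtains B where "B \<in> bases E" "{a, b} \<in> B"
proof -
  have "forest {}" by (simp add: forest_def)
  moreover have "(a, b) \<notin> conn {}" using assms(3) by (simp add: conn_def arcs_def)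
  ultimately have "forest {{a, b}}" by (rule forest_insert)
  then obtain B where "B \<in> bases E" "{{a, b}} \<subseteq> B"
    using forest_extends[OF assms(1), of "{{a, b}}"] assms(2) by auto
  then show thesis using that by auto
qed

lemma card_bases_delete:
  assumes "finite E"
  shows "card {B \<in> bases E. e \<notin> B} \<le> card (bases (E - {e}))"
proof (rule card_mono)
  show "finite (bases (E - {e}))" using assms by (simp add: finite_bases)
  show "{B \<in> bases E. e \<notin> B} \<subseteq> bases (E - {e})"
    by (auto simp: bases_def arcs_def)
qed

text \<open>
  A bridge belongs to every basis, so bases are determined by their other edges.
\<close>
lemma card_bases_bridge:
  assumes fin: "finite E" and bridge: "(a, b) \<notin> conn (E - {{a, b}})"
  shows "card (bases E) \<le> card (bases (E - {{a, b}}))"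
proof (cases "{a, b} \<in> E")
  case True
  let ?e = "{a, b}"
  have eB: "?e \<in> B" if B: "B \<in> bases E" for B
  proof (rule ccontr)
    assume "?e \<notin> B"
    then have "B \<subseteq> E - {?e}" using basesD(1)[OF B] by auto
    moreover have "(a, b) \<in> conn B" using basesD(3)[OF B] True by auto
    ultimately show False using bridge conn_monoD by metis
  qed
  show ?thesis
  proof (rule card_inj_on_le)
    show "inj_on (\<lambda>B. B - {?e}) (bases E)"
      by (rule inj_onI) (metis eB insert_Diff)
    show "finite (bases (E - {?e}))" using fin by (simp add: finite_bases)
    show "(\<lambda>B. B - {?e}) ` bases E \<subseteq> bases (E - {?e})"
    proof
      fix F assume "F \<in> (\<lambda>B. B - {?e}) ` bases E"
      then obtain B where B: "B \<in> bases E" and F: "F = B - {?e}" by auto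
      have FE: "F \<subseteq> E - {?e}" using basesD(1)[OF B] F by auto
      have "(x, y) \<in> conn F" if xy: "{x, y} \<in> E - {?e}" for x y
      proof (rule ccontr)
        assume n: "(x, y) \<notin> conn F"
        have "insert {a, b} F = B" using eB[OF B] F by auto
        moreover have "(x, y) \<in> conn B"
          using xy by (intro subsetD[OF basesD(3)[OF B]]) simp
        ultimately have "(x, y) \<in> conn (insert {a, b} F)" by simp
        then consider "(x, a) \<in> conn F" "(b, y) \<in> conn F" | "(x, b) \<in> conn F" "(a, y) \<in> conn F"
          using conn_insert[of x y a b F] n by blast
        then have "(a, b) \<in> conn (E - {?e})"
        proof cases
          case 1
          show ?thesis
            by (rule conn_trans[OF conn_monoD[OF conn_symD[OF 1(1)] FE]
                  conn_trans[OF conn_edge[OF xy] conn_monoD[OF conn_symD[OF 1(2)] FE]]])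
        next
          case 2
          show ?thesis
            by (rule conn_trans[OF conn_monoD[OF 2(2) FE]
                  conn_trans[OF conn_symD[OF conn_edge[OF xy]] conn_monoD[OF 2(1) FE]]])
        qed
        then show False using bridge by simp
      qed
      then have "arcs (E - {?e}) \<subseteq> conn F" by (simp add: subset_iff del: Diff_iff)
      moreover have "forest F" using forest_subset[OF basesD(2)[OF B], of F] F by blast
      ultimately show "F \<in> bases (E - {?e})" using FE by (simp add: bases_def)
    qed
  qed
qed simp

section \<open>Kirchhoff's voltages from spanning trees\<close>

text \<open>
  The path from \<open>a\<close> to \<open>b\<close> in the forest \<open>B\<close> runs through the edge \<open>{x, y}\<close>, from \<open>x\<close> to \<open>y\<close>.
\<close>
definition passes :: "'a \<Rightarrow> 'a \<Rightarrow> 'a \<Rightarrow> 'a \<Rightarrow> 'a set set \<Rightarrow> bool" where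
  "passes a b x y B \<longleftrightarrow> {x, y} \<in> B \<and> (a, x) \<in> conn (B - {{x, y}}) \<and> (y, b) \<in> conn (B - {{x, y}})"

lemma passes_reverse: "passes a b x y B \<longleftrightarrow> passes b a y x B"
  unfolding passes_def by (auto simp: insert_commute intro: conn_symD)

lemma passes_out_unique:
  assumes f: "forest B" and p: "passes a b x y B" and q: "passes a b x z B"
  shows "y = z"
proof (rule ccontr)
  assume ne: "y \<noteq> z"
  have xz: "{x, z} \<in> B" and zb: "(z, b) \<in> conn (B - {{x, z}})"
    and xy: "{x, y} \<in> B" and yb: "(y, b) \<in> conn (B - {{x, y}})"
    using p q by (auto simp: passes_def)
  have "(z, x) \<notin> conn (B - {{x, z}})"
    using forestD[OF f xz] conn_symD[of z x] by blast
  then have "(z, b) \<in> conn (B - {{x, z}} - {{x, y}})" by (rule conn_remove[OF zb])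
  then have zb': "(z, b) \<in> conn (B - {{x, y}})" by (rule conn_monoD) auto
  have "{x, z} \<in> B - {{x, y}}" using xz ne by (auto simp: doubleton_eq_iff)
  then have "(x, y) \<in> conn (B - {{x, y}})"
    using conn_trans[OF conn_edge conn_trans[OF zb' conn_symD[OF yb]]] by simp
  then show False using forestD[OF f xy] by simp
qed

lemma passes_in_unique:
  assumes "forest B" "passes a b y x B" "passes a b z x B"
  shows "y = z"
  using passes_out_unique assms passes_reverse by metis

text \<open>
  The path leaves \<open>x\<close>, so it must have entered \<open>x\<close> before: the last edge of its initial part, which
  acyclicity keeps apart from its final part.
\<close>
lemma passes_out_in:
  assumes f: "forest B" and p: "passes a b x y B" and "x \<noteq> a"
  shows "\<exists>z. passes a b z x B"
proof -
  have xy: "{x, y} \<in> B" and ax: "(a, x) \<in> conn (B - {{x, y}})" and yb: "(y, b) \<in> conn (B - {{x, y}})"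
    using p by (auto simp: passes_def)
  obtain z where z: "{z, x} \<in> B - {{x, y}}" and az: "(a, z) \<in> conn (B - {{x, y}} - {{z, x}})"
    using conn_last_edge[OF ax] assms(3) by metis
  have "(a, z) \<in> conn (B - {{z, x}})" by (rule conn_monoD[OF az]) auto
  moreover have "(x, b) \<in> conn (B - {{z, x}})"
  proof -
    have "(y, x) \<notin> conn (B - {{x, y}})"
      using forestD[OF f xy] conn_symD[of y x] by blast
    then have "(y, b) \<in> conn (B - {{x, y}} - {{x, z}})" by (rule conn_remove[OF yb])
    then have "(y, b) \<in> conn (B - {{z, x}})" by (rule conn_monoD) (auto simp: insert_commute)
    moreover have "(x, y) \<in> conn (B - {{z, x}})" using xy z by (intro conn_edge) auto
    ultimately show ?thesis by (rule conn_trans[rotated])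
  qed
  ultimately have "passes a b z x B" using z by (simp add: passes_def)
  then show ?thesis ..
qed

lemma passes_in_out:
  assumes "forest B" "passes a b y x B" "x \<noteq> b"
  shows "\<exists>z. passes a b x z B"
  using passes_out_in[of B b a x y] assms passes_reverse by metis

lemma not_passes_out_end:
  assumes "forest B" shows "\<not> passes a b b y B"
  using forestD[OF assms, of b y] conn_symD[of y b] unfolding passes_def by blast

lemma passes_in_end:
  assumes ab: "(a, b) \<in> conn B" "a \<noteq> b"
  shows "\<exists>z. passes a b z b B"
  using conn_last_edge[OF ab] unfolding passes_def by (metis conn_refl)

definition nbs :: "'a set set \<Rightarrow> 'a \<Rightarrow> 'a set" where
  "nbs E x = {y. {x, y} \<in> E}"

lemma card_Collect_le_1: "(\<And>y z. P y \<Longrightarrow> P z \<Longrightarrow> y = z) \<Longrightarrow> card {y. P y} = (if \<exists>y. P y then 1 else 0)"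
proof (cases "\<exists>y. P y")
  case True
  assume u: "\<And>y z. P y \<Longrightarrow> P z \<Longrightarrow> y = z"
  from True obtain y where "P y" ..
  then have "{y. P y} = {y}" using u by blast
  then show ?thesis using True by simp
qed simp

text \<open>
  Kirchhoff's current law for a single path: it enters each inner vertex as often as it leaves it, and
  at \<open>b\<close> it only enters.
\<close>
lemma passes_balance:
  assumes f: "forest B" and ab: "(a, b) \<in> conn B" "a \<noteq> b" and "x \<noteq> a"
  shows "real (card {y. passes a b y x B}) - real (card {y. passes a b x y B}) = (if x = b then 1 else 0)"
proof -
  have "card {y. passes a b y x B} = (if \<exists>y. passes a b y x B then 1 else 0)"
    by (rule card_Collect_le_1) (rule passes_in_unique[OF f])
  moreover have "card {y. passes a b x y B} = (if \<exists>y. passes a b x y B then 1 else 0)"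
    by (rule card_Collect_le_1) (rule passes_out_unique[OF f])
  moreover have "(\<exists>y. passes a b x y B) = (\<exists>y. passes a b y x B)" if "x \<noteq> b"
    using passes_out_in[OF f] passes_in_out[OF f] that assms(4) by blast
  ultimately show ?thesis
    using not_passes_out_end[OF f] passes_in_end[OF ab] by auto
qed

definition laplacian :: "'a set set \<Rightarrow> ('a \<Rightarrow> real) \<Rightarrow> 'a \<Rightarrow> real" where
  "laplacian E f x = (\<Sum>y\<in>nbs E x. f x - f y)"

text \<open>
  The potential on the network \<open>E\<close> of unit resistors when \<open>a\<close> is kept at 0 and \<open>b\<close> at 1.
\<close>
definition voltage :: "'a set set \<Rightarrow> 'a \<Rightarrow> 'a \<Rightarrow> ('a \<Rightarrow> real) \<Rightarrow> bool" where
  "voltage E a b f \<longleftrightarrow> f a = 0 \<and> f b = 1 \<and> (\<forall>x. 0 \<le> f x \<and> f x \<le> 1) \<and>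
     (\<forall>x. x \<noteq> a \<longrightarrow> x \<noteq> b \<longrightarrow> laplacian E f x = 0)"

lemma edge_set_verts: "edge_set E \<Longrightarrow> finite (\<Union>E)"
  by (auto simp: edge_set_def)

lemma finite_nbs [simp]: "edge_set E \<Longrightarrow> finite (nbs E x)"
  by (rule finite_subset[OF _ edge_set_verts]) (auto simp: nbs_def)

lemma edge_set_irrefl: "edge_set E \<Longrightarrow> {x} \<notin> E"
  by (force simp: edge_set_def)

text \<open>
  Bases in which the edge \<open>{a, b}\<close> separates \<open>x\<close> from \<open>a\<close>.  Their number, normalised, will be the voltage at \<open>x\<close>.
\<close>
definition far_bases :: "'a set set \<Rightarrow> 'a \<Rightarrow> 'a \<Rightarrow> 'a \<Rightarrow> 'a set set set" where
  "far_bases E a b x = {B \<in> bases E. {a, b} \<in> B \<and> (x, b) \<in> conn (B - {{a, b}})}"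

text \<open>
  Trade the edge \<open>{a, b}\<close> for the edge \<open>{x, y}\<close> and back: when \<open>{a, b}\<close> is removed, \<open>x\<close> stays with \<open>a\<close>
  and \<open>y\<close> with \<open>b\<close>, so \<open>{x, y}\<close> reconnects the two parts and the path from \<open>a\<close> to \<open>b\<close> then crosses it.
\<close>
lemma card_passing_bases:
  assumes ab: "{a, b} \<in> E" and xy: "{x, y} \<in> E"
  shows "card {B \<in> bases E. passes a b x y B} = card (far_bases E a b y - far_bases E a b x)"
proof (rule bij_betw_same_card)
  define \<phi> where "\<phi> u v s t B = insert {s, t} (B - {{u, v}})" for u v s t :: 'a and B
  show "bij_betw (\<phi> x y a b) {B \<in> bases E. passes a b x y B} (far_bases E a b y - far_bases E a b x)"
  proof (rule bij_betw_byWitness[where f' = "\<phi> a b x y"])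
    have fwd: "\<phi> x y a b B \<in> far_bases E a b y - far_bases E a b x \<and> \<phi> a b x y (\<phi> x y a b B) = B"
      if "B \<in> bases E" and p: "passes a b x y B" for B
    proof -
      let ?F = "B - {{x, y}}"
      have xyB: "{x, y} \<in> B" and ax: "(a, x) \<in> conn ?F" and yb: "(y, b) \<in> conn ?F"
        using p by (auto simp: passes_def)
      note ex = bases_exchange[OF that(1) xyB ab conn_symD[OF ax] conn_symD[OF yb]]
      have abF: "{a, b} \<notin> ?F" by (rule contrapos_nn[OF ex(2)]) (rule conn_edge)
      then have eq: "\<phi> x y a b B - {{a, b}} = ?F" by (auto simp: \<phi>_def)
      have "(x, b) \<notin> conn ?F"
        by (rule contrapos_nn[OF forestD[OF basesD(2)[OF that(1)] xyB]]) (rule conn_trans[OF _ conn_symD[OF yb]])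
      moreover have "\<phi> x y a b B \<in> bases E" "{a, b} \<in> \<phi> x y a b B"
        using ex(1) by (simp_all add: \<phi>_def)
      ultimately have "\<phi> x y a b B \<in> far_bases E a b y - far_bases E a b x"
        using yb by (simp add: far_bases_def eq)
      moreover have "\<phi> a b x y (\<phi> x y a b B) = B"
        unfolding \<phi>_def[of a b] eq using xyB by auto
      ultimately show ?thesis ..
    qed
    have bwd: "\<phi> a b x y B \<in> bases E \<and> passes a b x y (\<phi> a b x y B) \<and> \<phi> x y a b (\<phi> a b x y B) = B"
      if B: "B \<in> far_bases E a b y - far_bases E a b x" for B
    proof -
      let ?F = "B - {{a, b}}"
      have bB: "B \<in> bases E" and abB: "{a, b} \<in> B" and yb: "(y, b) \<in> conn ?F" and xb: "(x, b) \<notin> conn ?F"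
        using B by (auto simp: far_bases_def)
      have "insert {a, b} ?F = B" using abB by auto
      moreover have "(x, y) \<in> conn B" using basesD(3)[OF bB] xy by auto
      ultimately consider "(x, y) \<in> conn ?F" | "(x, a) \<in> conn ?F" | "(x, b) \<in> conn ?F"
        using conn_insert[of x y a b ?F] by auto
      then have ax: "(a, x) \<in> conn ?F"
      proof cases
        case 1
        with xb show ?thesis using conn_trans[OF 1 yb] by simp
      next
        case 2
        then show ?thesis by (rule conn_symD)
      next
        case 3
        with xb show ?thesis by simp
      qed
      note ex = bases_exchange[OF bB abB xy ax yb]
      have xyF: "{x, y} \<notin> ?F" by (rule contrapos_nn[OF ex(2)]) (rule conn_edge)
      then have eq: "\<phi> a b x y B - {{x, y}} = ?F" by (auto simp: \<phi>_def)
      have "passes a b x y (\<phi> a b x y B)"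
        unfolding passes_def eq using ax yb by (simp add: \<phi>_def)
      moreover have "\<phi> x y a b (\<phi> a b x y B) = B"
        unfolding \<phi>_def[of x y] eq using abB by auto
      ultimately show ?thesis using ex(1) by (simp add: \<phi>_def)
    qed
    show "\<forall>B\<in>{B \<in> bases E. passes a b x y B}. \<phi> a b x y (\<phi> x y a b B) = B"
      using fwd by blast
    show "\<forall>B\<in>far_bases E a b y - far_bases E a b x. \<phi> x y a b (\<phi> a b x y B) = B"
      using bwd by blast
    show "\<phi> x y a b ` {B \<in> bases E. passes a b x y B} \<subseteq> far_bases E a b y - far_bases E a b x"
      using fwd by blast
    show "\<phi> a b x y ` (far_bases E a b y - far_bases E a b x) \<subseteq> {B \<in> bases E. passes a b x y B}"
      using bwd by blast
  qed
qed

lemma card_diff_swap: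
  assumes "finite A" "finite B"
  shows "real (card A) - real (card B) = real (card (A - B)) - real (card (B - A))"
proof -
  have "card A = card (A - B) + card (A \<inter> B)"
    using card_Un_disjoint[of "A - B" "A \<inter> B"] assms by (simp add: Un_Diff_Int Int_Diff)
      (metis Diff_Int_distrib Int_Diff_disjoint Int_commute Un_Diff_Int)
  moreover have "card B = card (B - A) + card (A \<inter> B)"
    by (metis assms(2) add.commute card_Diff_subset_Int card_mono finite_Int inf.commute inf_le2 le_add_diff_inverse)
  ultimately show ?thesis by simp
qed

text \<open>
  Voltage differences along an edge count the bases whose path from \<open>a\<close> to \<open>b\<close> crosses it, with sign, so
  the current law for paths makes the function harmonic.  The total current is the reciprocal of the
  proportion of bases that contain \<open>{a, b}\<close>.
\<close>
theorem tree_voltage: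
  assumes E: "edge_set E" and ab: "{a, b} \<in> E"
  defines "M \<equiv> card {B \<in> bases E. {a, b} \<in> B}"
  obtains f where "voltage E a b f" "laplacian E f b = real (card (bases E)) / real M"
proof -
  have finE: "finite E" and ne: "a \<noteq> b" using E edge_set_irrefl[OF E, of a] ab by (auto simp: edge_set_def)
  have finB: "finite (bases E)" using finE by (rule finite_bases)
  define f where "f x = real (card (far_bases E a b x)) / real M" for x
  have finF: "finite (far_bases E a b x)" for x
    using finB by (simp add: far_bases_def)
  obtain B0 where "B0 \<in> bases E" "{a, b} \<in> B0" using edge_in_some_basis[OF finE ab ne] .
  then have Mpos: "M > 0" unfolding M_def using finB by (auto simp: card_gt_0_iff)
  have fb: "f b = 1" using Mpos by (simp add: f_def far_bases_def M_def)
  have "far_bases E a b a = {}"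
    using forestD[OF basesD(2), of _ E a b] by (auto simp: far_bases_def)
  then have fa: "f a = 0" by (simp add: f_def)
  have "far_bases E a b x \<subseteq> {B \<in> bases E. {a, b} \<in> B}" for x
    by (auto simp: far_bases_def)
  then have le: "card (far_bases E a b x) \<le> M" for x
    unfolding M_def using finB by (intro card_mono) auto
  then have range: "0 \<le> f x \<and> f x \<le> 1" for x
    using Mpos by (simp add: f_def)
  \<comment> \<open>counting pairs of a neighbour and a basis in two ways\<close>
  have sum_card: "(\<Sum>y\<in>nbs E x. real (card {B \<in> bases E. P y B})) = (\<Sum>B\<in>bases E. real (card {y. P y B}))"
    if "\<And>y B. B \<in> bases E \<Longrightarrow> P y B \<Longrightarrow> {x, y} \<in> E" for x and P :: "'a \<Rightarrow> 'a set set \<Rightarrow> bool"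
  proof -
    have "(\<Sum>y\<in>nbs E x. real (card {B \<in> bases E. P y B})) = (\<Sum>y\<in>nbs E x. \<Sum>B\<in>bases E. if P y B then 1 else 0)"
      by (intro sum.cong refl) (simp add: sum.If_cases finB Int_def)
    also have "\<dots> = (\<Sum>B\<in>bases E. \<Sum>y\<in>nbs E x. if P y B then 1 else 0)"
      by (rule sum.swap)
    also have "\<dots> = (\<Sum>B\<in>bases E. real (card {y. P y B}))"
    proof (intro sum.cong refl)
      fix B assume "B \<in> bases E"
      then have "{y \<in> nbs E x. P y B} = {y. P y B}" using that by (auto simp: nbs_def)
      then show "(\<Sum>y\<in>nbs E x. if P y B then 1 else 0) = real (card {y. P y B})"
        using E by (simp add: sum.If_cases Int_def)
    qed
    finally show ?thesis .
  qed
  have laplacian: "laplacian E f x = (if x = b then real (card (bases E)) / real M else 0)" if "x \<noteq> a" for x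
  proof -
    have "laplacian E f x = (\<Sum>y\<in>nbs E x. (real (card {B \<in> bases E. passes a b y x B})
        - real (card {B \<in> bases E. passes a b x y B})) / M)"
      unfolding laplacian_def
    proof (intro sum.cong refl)
      fix y assume "y \<in> nbs E x"
      then have xy: "{x, y} \<in> E" "{y, x} \<in> E" by (simp_all add: nbs_def insert_commute)
      show "f x - f y = (real (card {B \<in> bases E. passes a b y x B})
          - real (card {B \<in> bases E. passes a b x y B})) / M"
        unfolding f_def card_passing_bases[OF ab xy(1)] card_passing_bases[OF ab xy(2)]
        using card_diff_swap[OF finF[of x] finF[of y]] by (simp add: diff_divide_distrib[symmetric])
    qed
    also have "\<dots> = ((\<Sum>y\<in>nbs E x. real (card {B \<in> bases E. passes a b y x B}))
        - (\<Sum>y\<in>nbs E x. real (card {B \<in> bases E. passes a b x y B}))) / M"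
      by (simp only: sum_divide_distrib[symmetric] sum_subtractf)
    also have "\<dots> = (\<Sum>B\<in>bases E. real (card {y. passes a b y x B}) - real (card {y. passes a b x y B})) / M"
    proof -
      have 1: "(\<Sum>y\<in>nbs E x. real (card {B \<in> bases E. passes a b y x B})) = (\<Sum>B\<in>bases E. real (card {y. passes a b y x B}))"
        by (rule sum_card) (use basesD(1) in \<open>auto simp: passes_def insert_commute\<close>)
      have 2: "(\<Sum>y\<in>nbs E x. real (card {B \<in> bases E. passes a b x y B})) = (\<Sum>B\<in>bases E. real (card {y. passes a b x y B}))"
        by (rule sum_card) (use basesD(1) in \<open>auto simp: passes_def\<close>)
      show ?thesis unfolding 1 2 by (simp add: sum_subtractf)
    qed
    also have "\<dots> = (\<Sum>B\<in>bases E. if x = b then 1 else 0) / M"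
    proof -
      have "real (card {y. passes a b y x B}) - real (card {y. passes a b x y B}) = (if x = b then 1 else 0)"
        if "B \<in> bases E" for B
        using basesD(2,3)[OF that] ab by (intro passes_balance ne \<open>x \<noteq> a\<close>) auto
      then show ?thesis by simp
    qed
    finally show ?thesis by simp
  qed
  have "voltage E a b f" using fa fb range laplacian by (simp add: voltage_def)
  moreover have "laplacian E f b = real (card (bases E)) / real M" using laplacian ne by simp
  ultimately show thesis by (rule that)
qed

text \<open>
  Every edge contributes twice, once in each orientation.
\<close>
definition energy :: "'a set set \<Rightarrow> ('a \<Rightarrow> real) \<Rightarrow> real" where
  "energy E f = (\<Sum>(x, y)\<in>arcs E. (f x - f y)\<^sup>2)"

lemma finite_arcs: "edge_set E \<Longrightarrow> finite (arcs E)"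
  by (rule finite_subset[of _ "\<Union>E \<times> \<Union>E"]) (auto dest: edge_set_verts)

lemma sum_arcs_flip: "(\<Sum>(x, y)\<in>arcs E. g x y) = (\<Sum>(x, y)\<in>arcs E. g y x)"
  by (rule sum.reindex_bij_witness[of _ prod.swap prod.swap]) (auto simp: insert_commute)

lemma sum_arcs_nbs:
  assumes "edge_set E"
  shows "(\<Sum>(x, y)\<in>arcs E. g x y) = (\<Sum>x\<in>\<Union>E. \<Sum>y\<in>nbs E x. g x y)"
proof -
  have "arcs E = (SIGMA x:\<Union>E. nbs E x)" by (auto simp: nbs_def)
  then show ?thesis using assms by (simp add: sum.Sigma edge_set_verts)
qed

text \<open>
  Discrete summation by parts.
\<close>
lemma green:
  assumes "edge_set E"
  shows "(\<Sum>(x, y)\<in>arcs E. (f x - f y) * (h x - h y)) = 2 * (\<Sum>x\<in>\<Union>E. h x * laplacian E f x)"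
proof -
  have "(\<Sum>(x, y)\<in>arcs E. (f x - f y) * (h x - h y))
      = (\<Sum>(x, y)\<in>arcs E. h x * (f x - f y)) + (\<Sum>(x, y)\<in>arcs E. h y * (f y - f x))"
    by (simp add: sum.distrib[symmetric] case_prod_unfold algebra_simps)
  also have "(\<Sum>(x, y)\<in>arcs E. h y * (f y - f x)) = (\<Sum>(x, y)\<in>arcs E. h x * (f x - f y))"
    by (rule sum_arcs_flip)
  also have "(\<Sum>(x, y)\<in>arcs E. h x * (f x - f y)) = (\<Sum>x\<in>\<Union>E. h x * laplacian E f x)"
    by (simp add: sum_arcs_nbs[OF assms] laplacian_def sum_distrib_left)
  finally show ?thesis by simp
qed

lemma sum_harmonic:
  assumes "edge_set E" "voltage E a b f" "{a, b} \<in> E" "a \<noteq> b"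
  shows "(\<Sum>x\<in>\<Union>E. h x * laplacian E f x) = h a * laplacian E f a + h b * laplacian E f b"
proof -
  have "(\<Sum>x\<in>\<Union>E. h x * laplacian E f x) = (\<Sum>x\<in>{a, b}. h x * laplacian E f x)"
    using assms by (intro sum.mono_neutral_right) (auto simp: edge_set_verts voltage_def)
  then show ?thesis using assms(4) by simp
qed

lemma voltage_energy:
  assumes "edge_set E" "voltage E a b f" "{a, b} \<in> E" "a \<noteq> b"
  shows "energy E f = 2 * laplacian E f b"
  using green[OF assms(1), of f f] sum_harmonic[OF assms, of f] assms(2)
  by (simp add: energy_def power2_eq_square voltage_def)

text \<open>
  The current that flows into the network at \<open>b\<close> flows out at \<open>a\<close>.
\<close>
lemma voltage_current:
  assumes "edge_set E" "voltage E a b f" "{a, b} \<in> E" "a \<noteq> b"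
  shows "laplacian E f b = (\<Sum>y\<in>nbs E a. f y)"
proof -
  have "laplacian E f a + laplacian E f b = 0"
    using green[OF assms(1), of f "\<lambda>_. 1"] sum_harmonic[OF assms, of "\<lambda>_. 1"] by simp
  moreover have "laplacian E f a = - (\<Sum>y\<in>nbs E a. f y)"
    using assms(2) by (simp add: laplacian_def voltage_def sum_negf)
  ultimately show ?thesis by simp
qed

text \<open>
  The difference \<open>g - f\<close> vanishes where \<open>f\<close> is not harmonic, so it is orthogonal to \<open>f\<close>, and the energy
  of \<open>g\<close> is the sum of the energies of \<open>f\<close> and \<open>g - f\<close>.
\<close>
lemma dirichlet_principle:
  assumes "edge_set E" "voltage E a b f" "{a, b} \<in> E" "a \<noteq> b" and g: "g a = 0" "g b = 1"
  shows "energy E f \<le> energy E g"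
proof -
  \<comment> \<open>orthogonality, by Green's formula\<close>
  have "2 * (\<Sum>(x, y)\<in>arcs E. (f x - f y) * ((g x - f x) - (g y - f y))) = 0"
    using green[OF assms(1), of f "\<lambda>x. g x - f x"] sum_harmonic[OF assms(1-4), of "\<lambda>x. g x - f x"] assms(2) g
    by (simp add: voltage_def)
  moreover have "energy E g - energy E f
      = 2 * (\<Sum>(x, y)\<in>arcs E. (f x - f y) * ((g x - f x) - (g y - f y)))
        + (\<Sum>(x, y)\<in>arcs E. ((g x - f x) - (g y - f y))\<^sup>2)"
    by (simp add: energy_def sum.distrib[symmetric] sum_subtractf[symmetric] sum_distrib_left
        case_prod_unfold power2_eq_square algebra_simps)
  moreover have "(\<Sum>(x, y)\<in>arcs E. ((g x - f x) - (g y - f y))\<^sup>2) \<ge> 0"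
    by (intro sum_nonneg) auto
  ultimately show ?thesis by simp
qed

text \<open>
  Restrict the voltage of \<open>E\<close> to the subnetwork \<open>U\<close>.  This loses energy, and the voltage of \<open>U\<close> has still
  less.  Both energies are twice the total current; for \<open>E\<close> it is given by \<open>tree_voltage\<close>.
\<close>
theorem rayleigh:
  assumes U: "edge_set U" "{a, b} \<in> U" "voltage U a b f"
    and E: "edge_set E" and j: "inj j" "\<And>e. e \<in> U \<Longrightarrow> j ` e \<in> E"
  shows "(\<Sum>y\<in>nbs U a. f y) * real (card {B \<in> bases E. {j a, j b} \<in> B}) \<le> real (card (bases E))"
proof -
  have ne: "a \<noteq> b" using edge_set_irrefl[OF U(1), of a] U(2) by auto
  have jab: "{j a, j b} \<in> E" using j(2)[OF U(2)] by simp
  have jne: "j a \<noteq> j b" using ne j(1) by (simp add: inj_eq)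
  obtain g where g: "voltage E (j a) (j b) g"
      "laplacian E g (j b) = real (card (bases E)) / real (card {B \<in> bases E. {j a, j b} \<in> B})"
    using tree_voltage[OF E jab] by blast
  have "2 * (\<Sum>y\<in>nbs U a. f y) = energy U f"
    using voltage_energy[OF U(1,3,2) ne] voltage_current[OF U(1,3,2) ne] by simp
  also have "\<dots> \<le> energy U (g \<circ> j)"
    using g(1) by (intro dirichlet_principle[OF U(1,3,2) ne]) (simp_all add: voltage_def)
  also have "\<dots> \<le> energy E g"
  proof -
    have "energy U (g \<circ> j) = (\<Sum>(x, y)\<in>map_prod j j ` arcs U. (g x - g y)\<^sup>2)"
      unfolding energy_def
      by (subst sum.reindex) (auto intro: inj_on_subset[OF prod.inj_map[OF j(1) j(1)]] simp: case_prod_unfold)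
    also have "\<dots> \<le> (\<Sum>(x, y)\<in>arcs E. (g x - g y)\<^sup>2)"
      using j(2) by (intro sum_mono2 finite_arcs E) force+
    finally show ?thesis by (simp add: energy_def)
  qed
  also have "\<dots> = 2 * laplacian E g (j b)" by (rule voltage_energy[OF E g(1) jab jne])
  finally have *: "(\<Sum>y\<in>nbs U a. f y) \<le> real (card (bases E)) / real (card {B \<in> bases E. {j a, j b} \<in> B})"
    using g(2) by simp
  show ?thesis
  proof (cases "card {B \<in> bases E. {j a, j b} \<in> B} = 0")
    case False
    then show ?thesis using * by (simp add: field_simps)
  qed simp
qed

section \<open>Escape probabilities of the random walk\<close>

abbreviation paths :: "nat \<Rightarrow> (nat \<Rightarrow> 'a) measure" where
  "paths n \<equiv> PiM {0..<n} (\<lambda>_. count_space UNIV)"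

text \<open>
  The law of the first \<open>n\<close> positions of the walk.
\<close>
abbreviation srw_prefix :: "'a ugraph \<Rightarrow> 'a \<Rightarrow> nat \<Rightarrow> (nat \<Rightarrow> 'a) measure" where
  "srw_prefix G v n \<equiv> Ionescu_Tulcea.C (srw_kernel G v) (\<lambda>_. count_space UNIV) 0 n (\<lambda>_. undefined)"

lemma start_in_space: "(\<lambda>_. undefined) \<in> space (paths 0)"
  by (simp add: space_PiM)

lemma pred_coordinate: "m < n \<Longrightarrow> Measurable.pred (paths n) (\<lambda>\<omega>. P (\<omega> m))"
  by (rule measurable_compose[OF measurable_component_singleton]) auto

lemma sets_srw_prefix: "sets (srw_prefix G v n) = sets (paths n)"
  using Ionescu_Tulcea.sets_C[OF Ionescu_Tulcea_srw_kernel start_in_space] by simp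

lemma space_srw_prefix: "space (srw_prefix G v n) = space (paths n)"
  by (rule sets_eq_imp_space_eq[OF sets_srw_prefix])

lemma prob_space_srw_prefix: "prob_space (srw_prefix G v n)"
  using Ionescu_Tulcea.prob_space_C[OF Ionescu_Tulcea_srw_kernel start_in_space] .

text \<open>
  Events that depend on the first \<open>n\<close> positions only can be measured in the finite-dimensional law.
\<close>
lemma emeasure_srw:
  assumes P: "\<And>\<omega>. P (restrict \<omega> {0..<n}) = P \<omega>" and X: "{\<omega> \<in> space (paths n). P \<omega>} \<in> sets (paths n)"
  shows "emeasure (srw G v) {\<omega>. P \<omega>} = emeasure (srw_prefix G v n) {\<omega> \<in> space (paths n). P \<omega>}"
    and "{\<omega>. P \<omega>} \<in> sets (srw G v)"
proof -
  interpret IT: Ionescu_Tulcea "srw_kernel G v" "\<lambda>_. count_space UNIV"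
    by (rule Ionescu_Tulcea_srw_kernel)
  let ?X = "{\<omega> \<in> space (paths n). P \<omega>}"
  have emb: "IT.PF.emb UNIV {0..<n} ?X = {\<omega>. P \<omega>}"
    by (auto simp: prod_emb_def space_PiM P)
  have "emeasure (srw G v) (IT.PF.emb UNIV {0..<n} ?X) = emeasure (IT.CI {0..<n}) ?X"
    unfolding srw_def by (rule IT.lim) (use X in auto)
  also have "\<dots> = emeasure (srw_prefix G v n) (IT.PF.emb {0..<n} {0..<n} ?X)"
    by (rule IT.emeasure_CI) (use X in auto)
  also have "IT.PF.emb {0..<n} {0..<n} ?X = ?X"
    using sets.sets_into_space[OF X] by (intro prod_emb_id) (simp add: space_PiM)
  finally show "emeasure (srw G v) {\<omega>. P \<omega>} = emeasure (srw_prefix G v n) ?X"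
    unfolding emb .
  have "IT.PF.emb UNIV {0..<n} ?X \<in> sets (PiM UNIV (\<lambda>_. count_space UNIV))"
    using X by (intro sets_PiM_I_finite measurable_prod_emb) auto
  then show "{\<omega>. P \<omega>} \<in> sets (srw G v)"
    unfolding emb srw_def IT.PF.sets_lim .
qed

lemma nn_integral_srw_prefix_Suc:
  assumes "\<phi> \<in> borel_measurable (paths (Suc n))"
  shows "(\<integral>\<^sup>+\<omega>. \<phi> \<omega> \<partial>srw_prefix G v (Suc n))
    = (\<integral>\<^sup>+\<omega>. (\<integral>\<^sup>+x. \<phi> (fun_upd \<omega> n x) \<partial>srw_kernel G v n \<omega>) \<partial>srw_prefix G v n)"
proof -
  interpret IT: Ionescu_Tulcea "srw_kernel G v" "\<lambda>_. count_space UNIV"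
    by (rule Ionescu_Tulcea_srw_kernel)
  have m: "IT.eP n \<in> srw_prefix G v n \<rightarrow>\<^sub>M subprob_algebra (paths (Suc n))"
    using IT.measurable_eP by (subst measurable_cong_sets[OF sets_srw_prefix refl])
  have "(\<integral>\<^sup>+\<omega>. \<phi> \<omega> \<partial>srw_prefix G v (Suc n)) = (\<integral>\<^sup>+\<omega>. (\<integral>\<^sup>+\<omega>'. \<phi> \<omega>' \<partial>IT.eP n \<omega>) \<partial>srw_prefix G v n)"
    using nn_integral_bind[OF assms m] by simp
  also have "\<dots> = (\<integral>\<^sup>+\<omega>. (\<integral>\<^sup>+x. \<phi> (fun_upd \<omega> n x) \<partial>srw_kernel G v n \<omega>) \<partial>srw_prefix G v n)"
    using assms by (intro nn_integral_cong IT.nn_integral_eP) (simp_all add: space_srw_prefix)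
  finally show ?thesis .
qed

lemma nn_integral_srw_prefix_1:
  assumes "\<phi> \<in> borel_measurable (paths (Suc 0))"
  shows "(\<integral>\<^sup>+\<omega>. \<phi> \<omega> \<partial>srw_prefix G v (Suc 0)) = \<phi> (fun_upd (\<lambda>_. undefined) 0 v)"
proof -
  interpret IT: Ionescu_Tulcea "srw_kernel G v" "\<lambda>_. count_space UNIV"
    by (rule Ionescu_Tulcea_srw_kernel)
  have *: "(\<lambda>\<omega>. \<integral>\<^sup>+ x. \<phi> (fun_upd \<omega> 0 x) \<partial>srw_kernel G v 0 \<omega>) = (\<lambda>\<omega>. \<phi> (fun_upd \<omega> 0 v))"
    by (simp add: srw_kernel_def)
  have "(\<lambda>\<omega>. \<phi> (fun_upd \<omega> 0 v)) \<in> borel_measurable (paths 0)"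
    by (simp add: PiM_empty)
  then show ?thesis
    unfolding nn_integral_srw_prefix_Suc[OF assms] * IT.C.simps(1)
    by (subst nn_integral_return) (auto simp: space_PiM)
qed

text \<open>
  The point \<open>b\<close> is reached within \<open>n\<close> steps and before any return to \<open>a\<close>; time 0 is not counted as a visit,
  because the walk starts in \<open>a\<close>.
\<close>
definition hits_before :: "'a \<Rightarrow> 'a \<Rightarrow> nat \<Rightarrow> (nat \<Rightarrow> 'a) \<Rightarrow> bool" where
  "hits_before b a n \<omega> \<longleftrightarrow> (\<exists>m\<in>{1..n}. \<omega> m = b \<and> (\<forall>j\<in>{1..<m}. \<omega> j \<noteq> a))"

lemma pred_hits_before:
  assumes "n < N" shows "Measurable.pred (paths N) (hits_before b a n)"
  unfolding hits_before_def[abs_def]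
  by (intro pred_intros_finite pred_intros_logic pred_coordinate) (use assms in auto)

lemma hits_before_restrict: "hits_before b a n (restrict \<omega> {0..<Suc n}) = hits_before b a n \<omega>"
  by (auto simp: hits_before_def)

text \<open>
  The value of \<open>f\<close> at the walk stopped on its return to \<open>a\<close> or its arrival in \<open>b\<close>, where \<open>f\<close> is 0 and 1.
\<close>
definition stopped_value :: "'a \<Rightarrow> 'a \<Rightarrow> ('a \<Rightarrow> real) \<Rightarrow> nat \<Rightarrow> (nat \<Rightarrow> 'a) \<Rightarrow> ennreal" where
  "stopped_value b a f n \<omega> =
     (if hits_before b a n \<omega> then 1 else if \<exists>m\<in>{1..n}. \<omega> m = a then 0 else ennreal (f (\<omega> n)))"

lemma measurable_stopped_value: "stopped_value b a f n \<in> borel_measurable (paths (Suc n))"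
  unfolding stopped_value_def[abs_def]
proof (intro measurable_If)
  show "{\<omega> \<in> space (paths (Suc n)). hits_before b a n \<omega>} \<in> sets (paths (Suc n))"
    using pred_hits_before[of n "Suc n" b a] by (simp add: pred_def)
  have "Measurable.pred (paths (Suc n)) (\<lambda>\<omega>. \<exists>m\<in>{1..n}. \<omega> m = a)"
    by (intro pred_intros_finite pred_coordinate) auto
  then show "{\<omega> \<in> space (paths (Suc n)). \<exists>m\<in>{1..n}. \<omega> m = a} \<in> sets (paths (Suc n))"
    by (simp add: pred_def)
  show "(\<lambda>\<omega>. ennreal (f (\<omega> n))) \<in> borel_measurable (paths (Suc n))"
    by (rule measurable_compose[OF measurable_component_singleton]) auto
qed auto

definition average :: "'a ugraph \<Rightarrow> ('a \<Rightarrow> real) \<Rightarrow> 'a \<Rightarrow> ennreal" where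
  "average G f x = (\<integral>\<^sup>+y. ennreal (f y) \<partial>measure_pmf (pmf_of_set (neighbours G x)))"

text \<open>
  The stopped process is a supermartingale from time 1 on.  At time 0 the walk is in \<open>a\<close>, where \<open>f\<close> need not
  be superharmonic.
\<close>
lemma stopped_value_step:
  assumes f: "f a = 0" "f b = 1" "a \<noteq> b"
    and super: "\<And>x. x \<noteq> a \<Longrightarrow> x \<noteq> b \<Longrightarrow> average G f x \<le> ennreal (f x)"
    and n: "n \<ge> 1"
  shows "(\<integral>\<^sup>+x. stopped_value b a f (Suc n) (fun_upd \<omega> (Suc n) x) \<partial>srw_kernel G v (Suc n) \<omega>)
    \<le> stopped_value b a f n \<omega>"
proof -
  have hit: "hits_before b a (Suc n) (fun_upd \<omega> (Suc n) x) \<longleftrightarrow>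
      hits_before b a n \<omega> \<or> x = b \<and> (\<forall>j\<in>{1..n}. \<omega> j \<noteq> a)" for x
    by (force simp: hits_before_def atLeastAtMostSuc_conv atLeastLessThanSuc_atLeastAtMost)
  have ret: "(\<exists>m\<in>{1..Suc n}. fun_upd \<omega> (Suc n) x m = a) \<longleftrightarrow> x = a \<or> (\<exists>m\<in>{1..n}. \<omega> m = a)" for x
    by (auto simp: atLeastAtMostSuc_conv)
  consider "hits_before b a n \<omega>" | "\<not> hits_before b a n \<omega>" "\<exists>m\<in>{1..n}. \<omega> m = a"
    | "\<not> hits_before b a n \<omega>" "\<forall>m\<in>{1..n}. \<omega> m \<noteq> a" by blast
  then show ?thesis
  proof cases
    case 1
    then show ?thesis
      by (simp add: stopped_value_def hit srw_kernel_def)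
  next
    case 2
    then have "stopped_value b a f (Suc n) (fun_upd \<omega> (Suc n) x) = 0" for x
      unfolding stopped_value_def hit ret by auto
    then show ?thesis by simp
  next
    case 3
    have "\<omega> n \<noteq> a" "\<omega> n \<noteq> b" using 3 n by (auto simp: hits_before_def)
    have "stopped_value b a f (Suc n) (fun_upd \<omega> (Suc n) x) = ennreal (f x)" for x
      unfolding stopped_value_def hit ret using 3 f by auto
    then have "(\<integral>\<^sup>+x. stopped_value b a f (Suc n) (fun_upd \<omega> (Suc n) x) \<partial>srw_kernel G v (Suc n) \<omega>) = average G f (\<omega> n)"
      by (simp add: srw_kernel_def average_def)
    also have "\<dots> \<le> ennreal (f (\<omega> n))" by (rule super) fact+
    also have "\<dots> = stopped_value b a f n \<omega>" using 3 by (auto simp: stopped_value_def)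
    finally show ?thesis .
  qed
qed

lemma stopped_value_bound:
  assumes f: "f a = 0" "f b = 1" "a \<noteq> b"
    and super: "\<And>x. x \<noteq> a \<Longrightarrow> x \<noteq> b \<Longrightarrow> average G f x \<le> ennreal (f x)"
  shows "(\<integral>\<^sup>+\<omega>. stopped_value b a f (Suc n) \<omega> \<partial>srw_prefix G a (Suc (Suc n))) \<le> average G f a"
proof (induction n)
  case 0
  have hit: "hits_before b a (Suc 0) \<omega> \<longleftrightarrow> \<omega> (Suc 0) = b" for \<omega> by (auto simp: hits_before_def)
  have sv: "stopped_value b a f (Suc 0) \<omega> = ennreal (f (\<omega> (Suc 0)))" for \<omega>
    using f by (auto simp: stopped_value_def hit)
  have m: "(\<lambda>\<omega>. average G f (\<omega> 0)) \<in> borel_measurable (paths (Suc 0))"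
    by (rule measurable_compose[OF measurable_component_singleton]) auto
  have "(\<integral>\<^sup>+\<omega>. stopped_value b a f (Suc 0) \<omega> \<partial>srw_prefix G a (Suc (Suc 0)))
      = (\<integral>\<^sup>+\<omega>. average G f (\<omega> 0) \<partial>srw_prefix G a (Suc 0))"
    unfolding nn_integral_srw_prefix_Suc[OF measurable_stopped_value]
    by (simp add: sv srw_kernel_def average_def)
  also have "\<dots> = average G f a" by (subst nn_integral_srw_prefix_1[OF m]) simp
  finally show ?case by simp
next
  case (Suc n)
  have "(\<integral>\<^sup>+\<omega>. stopped_value b a f (Suc (Suc n)) \<omega> \<partial>srw_prefix G a (Suc (Suc (Suc n))))
      \<le> (\<integral>\<^sup>+\<omega>. stopped_value b a f (Suc n) \<omega> \<partial>srw_prefix G a (Suc (Suc n)))"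
    unfolding nn_integral_srw_prefix_Suc[OF measurable_stopped_value[of b a f "Suc (Suc n)"]]
    by (intro nn_integral_mono stopped_value_step f super) auto
  then show ?case using Suc.IH by (rule order_trans)
qed

lemma hit_event:
  "{\<omega>. \<exists>n\<ge>1. \<omega> n = b \<and> (\<forall>m. 1 \<le> m \<and> m < n \<longrightarrow> \<omega> m \<noteq> a)} = (\<Union>n. {\<omega>. hits_before b a (Suc n) \<omega>})"
proof -
  have "(\<exists>n\<ge>1. \<omega> n = b \<and> (\<forall>m. 1 \<le> m \<and> m < n \<longrightarrow> \<omega> m \<noteq> a)) \<longleftrightarrow> (\<exists>n. hits_before b a (Suc n) \<omega>)" for \<omega>
  proof
    assume "\<exists>n\<ge>1. \<omega> n = b \<and> (\<forall>m. 1 \<le> m \<and> m < n \<longrightarrow> \<omega> m \<noteq> a)"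
    then obtain n where "n \<ge> 1" "\<omega> n = b" "\<forall>m. 1 \<le> m \<and> m < n \<longrightarrow> \<omega> m \<noteq> a" by blast
    then have "hits_before b a (Suc n) \<omega>" by (auto simp: hits_before_def intro!: bexI[of _ n])
    then show "\<exists>n. hits_before b a (Suc n) \<omega>" ..
  next
    assume "\<exists>n. hits_before b a (Suc n) \<omega>"
    then obtain m where "m \<ge> 1" "\<omega> m = b" "\<forall>j\<in>{1..<m}. \<omega> j \<noteq> a"
      by (auto simp: hits_before_def)
    then show "\<exists>n\<ge>1. \<omega> n = b \<and> (\<forall>m. 1 \<le> m \<and> m < n \<longrightarrow> \<omega> m \<noteq> a)"
      by (intro exI[of _ m]) auto
  qed
  then show ?thesis by auto
qed

lemma hits_before_events:
  "emeasure (srw G v) {\<omega>. hits_before b a n \<omega>}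
     = emeasure (srw_prefix G v (Suc n)) {\<omega> \<in> space (paths (Suc n)). hits_before b a n \<omega>}"
  "{\<omega>. hits_before b a n \<omega>} \<in> sets (srw G v)"
  using emeasure_srw[of "hits_before b a n" "Suc n" G v] pred_hits_before[of n "Suc n" b a]
  by (simp_all add: hits_before_restrict pred_def)

text \<open>
  The stopped value is 1 once \<open>b\<close> has been reached in time, so its expectation bounds the probability;
  the expectation decreases from the average of \<open>f\<close> after one step.
\<close>
theorem hit_prob_le:
  assumes f: "f a = 0" "f b = 1" "a \<noteq> b"
    and super: "\<And>x. x \<noteq> a \<Longrightarrow> x \<noteq> b \<Longrightarrow> average G f x \<le> ennreal (f x)"
  shows "emeasure (srw G a) {\<omega>. \<exists>n\<ge>1. \<omega> n = b \<and> (\<forall>m. 1 \<le> m \<and> m < n \<longrightarrow> \<omega> m \<noteq> a)} \<le> average G f a"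
proof -
  have bound: "emeasure (srw G a) {\<omega>. hits_before b a (Suc n) \<omega>} \<le> average G f a" for n
  proof -
    let ?X = "{\<omega> \<in> space (paths (Suc (Suc n))). hits_before b a (Suc n) \<omega>}"
    have "?X \<in> sets (srw_prefix G a (Suc (Suc n)))"
      using pred_hits_before[of "Suc n" "Suc (Suc n)" b a] by (simp add: pred_def sets_srw_prefix del: Ionescu_Tulcea.C.simps)
    then have "emeasure (srw G a) {\<omega>. hits_before b a (Suc n) \<omega>}
        = (\<integral>\<^sup>+\<omega>. indicator ?X \<omega> \<partial>srw_prefix G a (Suc (Suc n)))"
      unfolding hits_before_events(1) by (rule nn_integral_indicator[symmetric])
    also have "\<dots> \<le> (\<integral>\<^sup>+\<omega>. stopped_value b a f (Suc n) \<omega> \<partial>srw_prefix G a (Suc (Suc n)))"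
      by (intro nn_integral_mono) (auto simp: stopped_value_def indicator_def)
    also have "\<dots> \<le> average G f a" by (rule stopped_value_bound[OF f super])
    finally show ?thesis .
  qed
  have inc: "incseq (\<lambda>n. {\<omega>. hits_before b a (Suc n) \<omega>})"
    by (rule incseq_SucI) (force simp: hits_before_def)
  have "(SUP n. emeasure (srw G a) {\<omega>. hits_before b a (Suc n) \<omega>})
      = emeasure (srw G a) (\<Union>n. {\<omega>. hits_before b a (Suc n) \<omega>})"
    by (rule SUP_emeasure_incseq[OF _ inc]) (use hits_before_events(2) in auto)
  then show ?thesis unfolding hit_event using bound by (metis SUP_least)
qed

lemma emeasure_cylinder:
  assumes "p 0 = v"
  shows "emeasure (srw G v) {\<omega>. \<forall>i\<le>n. \<omega> i = p i}
    = ennreal (\<Prod>i<n. pmf (pmf_of_set (neighbours G (p i))) (p (Suc i)))"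
proof -
  have pr: "Measurable.pred (paths (Suc n)) (\<lambda>\<omega>. \<forall>i\<in>{..n}. \<omega> i = p i)" for n
    by (intro pred_intros_finite pred_coordinate) auto
  then have S: "{\<omega> \<in> space (paths (Suc n)). \<forall>i\<le>n. \<omega> i = p i} \<in> sets (paths (Suc n))" for n
    by (simp add: pred_def)
  have mi: "(\<lambda>\<omega>. indicator {\<omega>. \<forall>i\<le>n. \<omega> i = p i} \<omega> :: ennreal) \<in> borel_measurable (paths (Suc n))" for n
    by (rule borel_measurable_indicator') (use S[of n] in simp)
  have "(\<integral>\<^sup>+\<omega>. indicator {\<omega>. \<forall>i\<le>n. \<omega> i = p i} \<omega> \<partial>srw_prefix G v (Suc n))
    = ennreal (\<Prod>i<n. pmf (pmf_of_set (neighbours G (p i))) (p (Suc i)))" for n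
  proof (induction n)
    case 0
    show ?case using mi[of 0] assms by (subst nn_integral_srw_prefix_1) (auto simp: indicator_def)
  next
    case (Suc n)
    have eq: "(\<integral>\<^sup>+x. indicator {\<omega>. \<forall>i\<le>Suc n. \<omega> i = p i} (fun_upd \<omega> (Suc n) x) \<partial>srw_kernel G v (Suc n) \<omega>)
        = ennreal (pmf (pmf_of_set (neighbours G (p n))) (p (Suc n))) * indicator {\<omega>. \<forall>i\<le>n. \<omega> i = p i} \<omega>" for \<omega>
    proof (cases "\<forall>i\<le>n. \<omega> i = p i")
      case True
      then have "indicator {\<omega>. \<forall>i\<le>Suc n. \<omega> i = p i} (fun_upd \<omega> (Suc n) x) = (indicator {p (Suc n)} x :: ennreal)" for x
        by (auto simp: indicator_def le_Suc_eq)
      then show ?thesis using True by (simp add: srw_kernel_def emeasure_pmf_single)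
    next
      case False
      then have "indicator {\<omega>. \<forall>i\<le>Suc n. \<omega> i = p i} (fun_upd \<omega> (Suc n) x) = (0 :: ennreal)" for x
        by (auto simp: indicator_def le_Suc_eq)
      then show ?thesis using False by simp
    qed
    have "(\<lambda>\<omega>. indicator {\<omega>. \<forall>i\<le>n. \<omega> i = p i} \<omega> :: ennreal) \<in> borel_measurable (srw_prefix G v (Suc n))"
      using mi[of n] by (subst measurable_cong_sets[OF sets_srw_prefix refl])
    then have "(\<integral>\<^sup>+\<omega>. indicator {\<omega>. \<forall>i\<le>Suc n. \<omega> i = p i} \<omega> \<partial>srw_prefix G v (Suc (Suc n)))
        = ennreal (pmf (pmf_of_set (neighbours G (p n))) (p (Suc n)))
          * (\<integral>\<^sup>+\<omega>. indicator {\<omega>. \<forall>i\<le>n. \<omega> i = p i} \<omega> \<partial>srw_prefix G v (Suc n))"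
      unfolding nn_integral_srw_prefix_Suc[OF mi[of "Suc n"]] eq by (rule nn_integral_cmult)
    also have "\<dots> = ennreal (\<Prod>i<Suc n. pmf (pmf_of_set (neighbours G (p i))) (p (Suc i)))"
      unfolding Suc.IH by (simp add: ennreal_mult' prod_nonneg mult.commute)
    finally show ?case .
  qed
  moreover have "emeasure (srw G v) {\<omega>. \<forall>i\<le>n. \<omega> i = p i}
      = (\<integral>\<^sup>+\<omega>. indicator {\<omega>. \<forall>i\<le>n. \<omega> i = p i} \<omega> \<partial>srw_prefix G v (Suc n))"
  proof -
    have "emeasure (srw G v) {\<omega>. \<forall>i\<le>n. \<omega> i = p i}
        = emeasure (srw_prefix G v (Suc n)) {\<omega> \<in> space (paths (Suc n)). \<forall>i\<le>n. \<omega> i = p i}"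
      by (rule emeasure_srw(1)[where P = "\<lambda>\<omega>. \<forall>i\<le>n. \<omega> i = p i", OF _ S]) simp
    also have "\<dots> = (\<integral>\<^sup>+\<omega>. indicator {\<omega> \<in> space (paths (Suc n)). \<forall>i\<le>n. \<omega> i = p i} \<omega> \<partial>srw_prefix G v (Suc n))"
      using S[of n] unfolding sets_srw_prefix[of G v, symmetric] by (rule nn_integral_indicator[symmetric])
    also have "\<dots> = (\<integral>\<^sup>+\<omega>. indicator {\<omega>. \<forall>i\<le>n. \<omega> i = p i} \<omega> \<partial>srw_prefix G v (Suc n))"
      unfolding space_srw_prefix[of G v, symmetric]
      by (rule nn_integral_cong) (simp only: indicator_def mem_Collect_eq simp_thms)
    finally show ?thesis .
  qed
  ultimately show ?thesis by simp
qed

lemma sets_hit_event: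
  "{\<omega>. \<exists>n\<ge>1. \<omega> n = b \<and> (\<forall>m. 1 \<le> m \<and> m < n \<longrightarrow> \<omega> m \<noteq> a)} \<in> sets (srw G v)"
  unfolding hit_event by (intro sets.countable_UN) (auto intro: hits_before_events(2))

lemma neighbours_eq_nbs: "neighbours G x = nbs (edges G) x"
  by (simp add: neighbours_def nbs_def adj_def)

text \<open>
  At an isolated vertex the next position of the walk is unspecified.  Raising the voltage to 1
  there keeps it superharmonic and changes nothing elsewhere, because an isolated vertex is nobody's neighbour.
\<close>
lemma hit_prob_le_voltage:
  assumes E: "edge_set (edges G)" and f: "voltage (edges G) a b f" and ab: "{a, b} \<in> edges G"
  shows "measure (srw G a) {\<omega>. \<exists>n\<ge>1. \<omega> n = b \<and> (\<forall>m. 1 \<le> m \<and> m < n \<longrightarrow> \<omega> m \<noteq> a)}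
    \<le> (\<Sum>y\<in>nbs (edges G) a. f y) / real (card (nbs (edges G) a))"
proof -
  let ?N = "nbs (edges G)"
  have ne: "a \<noteq> b" using edge_set_irrefl[OF E, of a] ab by auto
  have f0: "f a = 0" and f1: "f b = 1" and range: "\<And>x. 0 \<le> f x \<and> f x \<le> 1"
    and harm: "\<And>x. x \<noteq> a \<Longrightarrow> x \<noteq> b \<Longrightarrow> laplacian (edges G) f x = 0"
    using f by (auto simp: voltage_def)
  define g where "g x = (if ?N x = {} then 1 else f x)" for x
  have nonempty: "?N y \<noteq> {}" if "y \<in> ?N x" for x y
    using that by (auto simp: nbs_def insert_commute)
  have ab_ne: "?N a \<noteq> {}" "?N b \<noteq> {}" using ab by (auto simp: nbs_def insert_commute)
  have avg: "average G g x = ennreal ((\<Sum>y\<in>?N x. f y) / real (card (?N x)))" if "?N x \<noteq> {}" for x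
  proof -
    have "(\<Sum>y\<in>?N x. ennreal (g y)) = (\<Sum>y\<in>?N x. ennreal (f y))"
      by (intro sum.cong refl) (simp add: g_def nonempty)
    moreover have "card (?N x) > 0" using that E by (simp add: card_gt_0_iff)
    ultimately show ?thesis
      unfolding average_def neighbours_eq_nbs using that E range
      by (simp add: nn_integral_pmf_of_set sum_ennreal divide_ennreal sum_nonneg ennreal_of_nat_eq_real_of_nat)
  qed
  have super: "average G g x \<le> ennreal (g x)" if x: "x \<noteq> a" "x \<noteq> b" for x
  proof (cases "?N x = {}")
    case True
    have "average G g x \<le> (\<integral>\<^sup>+y. 1 \<partial>measure_pmf (pmf_of_set (neighbours G x)))"
      unfolding average_def using range by (intro nn_integral_mono) (auto simp: g_def)
    then show ?thesis using True by (simp add: g_def)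
  next
    case False
    then have "(\<Sum>y\<in>?N x. f y) / real (card (?N x)) = f x"
      using harm[OF x] E by (simp add: laplacian_def sum_subtractf field_simps)
    then show ?thesis using False by (simp add: avg g_def)
  qed
  have "emeasure (srw G a) {\<omega>. \<exists>n\<ge>1. \<omega> n = b \<and> (\<forall>m. 1 \<le> m \<and> m < n \<longrightarrow> \<omega> m \<noteq> a)} \<le> average G g a"
    by (rule hit_prob_le) (use f0 f1 ne ab_ne super in \<open>simp_all add: g_def\<close>)
  also have "\<dots> = ennreal ((\<Sum>y\<in>?N a. f y) / real (card (?N a)))" by (rule avg[OF ab_ne(1)])
  finally show ?thesis
    unfolding measure_def using range
    by (intro enn2real_leI) (auto simp: sum_nonneg)
qed

lemma prob_space_srw: "prob_space (srw G v)"
proof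
  have s: "space (srw G v) = UNIV"
  proof -
    interpret IT: Ionescu_Tulcea "srw_kernel G v" "\<lambda>_. count_space UNIV"
      by (rule Ionescu_Tulcea_srw_kernel)
    show ?thesis unfolding srw_def IT.PF.space_lim by (simp add: space_PiM)
  qed
  have "{\<omega> \<in> space (paths 1). True} \<in> sets (paths 1 :: (nat \<Rightarrow> 'a) measure)" by simp
  from emeasure_srw(1)[of "\<lambda>_. True", OF refl this, of G v]
  have "emeasure (srw G v) UNIV = emeasure (srw_prefix G v 1) (space (srw_prefix G v 1))"
    unfolding space_srw_prefix by simp
  then show "emeasure (srw G v) (space (srw G v)) = 1"
    unfolding s using prob_space.emeasure_space_1[OF prob_space_srw_prefix] by metis
qed

text \<open>
  The direct step to \<open>b\<close> has probability one over the degree, and the detour over \<open>c\<close> and \<open>d\<close> adds to it.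
\<close>
lemma hit_prob_gt:
  assumes fin: "\<And>x. finite (neighbours G x)"
    and adj: "adj G a b" "adj G a c" "adj G c d" "adj G d b" "a \<noteq> b" "c \<noteq> a" "d \<noteq> a" "c \<noteq> b"
  shows "measure (srw G a) {\<omega>. \<exists>n\<ge>1. \<omega> n = b \<and> (\<forall>m. 1 \<le> m \<and> m < n \<longrightarrow> \<omega> m \<noteq> a)}
    > 1 / real (card (neighbours G a))"
proof -
  interpret prob_space "srw G a" by (rule prob_space_srw)
  let ?H = "{\<omega>. \<exists>n\<ge>1. \<omega> n = b \<and> (\<forall>m. 1 \<le> m \<and> m < n \<longrightarrow> \<omega> m \<noteq> a)}"
  let ?p = "\<lambda>i::nat. [a, b] ! i" and ?q = "\<lambda>i::nat. [a, c, d, b] ! i"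
  let ?P = "{\<omega>. \<forall>i\<le>1. \<omega> i = ?p i}" and ?Q = "{\<omega>. \<forall>i\<le>3. \<omega> i = ?q i}"
  have cyl: "{\<omega>. \<forall>i\<le>n. \<omega> i = p i} \<in> sets (srw G a)" for n and p :: "nat \<Rightarrow> 'a"
  proof (rule emeasure_srw(2)[where n = "Suc n"])
    have "Measurable.pred (paths (Suc n)) (\<lambda>\<omega>. \<forall>i\<in>{..n}. \<omega> i = p i)"
      by (intro pred_intros_finite pred_coordinate) auto
    then show "{\<omega> \<in> space (paths (Suc n)). \<forall>i\<le>n. \<omega> i = p i} \<in> sets (paths (Suc n))"
      by (simp add: pred_def)
  qed simp
  have pos: "pmf (pmf_of_set (neighbours G x)) y = 1 / real (card (neighbours G x)) \<and> card (neighbours G x) > 0"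
    if "adj G x y" for x y
  proof -
    have y: "y \<in> neighbours G x" using that by (simp add: neighbours_def)
    then have "neighbours G x \<noteq> {}" by auto
    then show ?thesis using y fin[of x] by (simp add: card_gt_0_iff)
  qed
  have mP: "measure (srw G a) ?P = 1 / real (card (neighbours G a))"
    using emeasure_cylinder[of ?p a G 1] pos[OF adj(1)] by (simp add: measure_def)
  have "measure (srw G a) ?Q = (\<Prod>i<3. pmf (pmf_of_set (neighbours G (?q i))) (?q (Suc i)))"
    using emeasure_cylinder[of ?q a G 3] by (simp add: measure_def prod_nonneg)
  also have "\<dots> > 0"
    using pos[OF adj(2)] pos[OF adj(3)] pos[OF adj(4)] by (simp add: numeral_3_eq_3)
  finally have mQ: "measure (srw G a) ?Q > 0" .
  have "?P \<inter> ?Q = {}" using adj(8) by (auto dest!: spec[of _ 1])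
  then have "measure (srw G a) (?P \<union> ?Q) = measure (srw G a) ?P + measure (srw G a) ?Q"
    by (intro finite_measure_Union cyl)
  moreover have "?P \<union> ?Q \<subseteq> ?H"
  proof
    fix \<omega> assume "\<omega> \<in> ?P \<union> ?Q"
    then show "\<omega> \<in> ?H"
    proof
      assume "\<omega> \<in> ?P"
      then have "\<omega> 1 = b" by auto
      then show ?thesis by (auto intro!: exI[of _ 1])
    next
      assume Q: "\<omega> \<in> ?Q"
      have "\<omega> 1 = c" "\<omega> 2 = d" "\<omega> 3 = b" using Q by (auto simp: numeral_2_eq_2 numeral_3_eq_3)
      moreover have "m = 1 \<or> m = 2" if "1 \<le> m \<and> m < 3" for m :: nat using that by auto
      ultimately show ?thesis using adj(6,7) by (auto intro!: exI[of _ 3])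
    qed
  qed
  then have "measure (srw G a) (?P \<union> ?Q) \<le> measure (srw G a) ?H"
    by (intro finite_measure_mono sets_hit_event)
  ultimately show ?thesis using mP mQ by simp
qed

section \<open>The graphs \<open>U(k)\<close> and the factors \<open>F(k)\<close>\<close>

lemma lattice_edge: "{u, v} \<in> edges square_lattice \<longleftrightarrow> \<bar>fst u - fst v\<bar> + \<bar>snd u - snd v\<bar> = 1"
proof -
  have *: "dist (plane s) (plane t) = 1 \<longleftrightarrow> \<bar>fst s - fst t\<bar> + \<bar>snd s - snd t\<bar> = 1" for s t :: point
  proof -
    define x where "x = fst s - fst t"
    define y where "y = snd s - snd t"
    have "dist (plane s) (plane t) = sqrt (real_of_int (x\<^sup>2 + y\<^sup>2))"
      by (simp add: dist_norm plane_def cmod_def x_def y_def)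
    then have "dist (plane s) (plane t) = 1 \<longleftrightarrow> x\<^sup>2 + y\<^sup>2 = 1"
      by (metis of_int_1 of_int_eq_iff real_sqrt_eq_1_iff)
    also have "\<dots> \<longleftrightarrow> \<bar>x\<bar> + \<bar>y\<bar> = 1"
    proof
      assume sq: "x\<^sup>2 + y\<^sup>2 = 1"
      have "\<bar>x\<bar> \<le> x\<^sup>2" "\<bar>y\<bar> \<le> y\<^sup>2" using self_le_power[of "\<bar>x\<bar>" 2] self_le_power[of "\<bar>y\<bar>" 2]
        by (cases "x = 0"; cases "y = 0"; simp)+
      then have "\<bar>x\<bar> + \<bar>y\<bar> \<le> 1" using sq by linarith
      moreover have "x \<noteq> 0 \<or> y \<noteq> 0" using sq by auto
      ultimately show "\<bar>x\<bar> + \<bar>y\<bar> = 1" by linarith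
    next
      assume "\<bar>x\<bar> + \<bar>y\<bar> = 1"
      then have "x = 0 \<and> \<bar>y\<bar> = 1 \<or> \<bar>x\<bar> = 1 \<and> y = 0" by linarith
      then show "x\<^sup>2 + y\<^sup>2 = 1" by (auto simp: abs_if split: if_splits)
    qed
    finally show ?thesis by (simp add: x_def y_def)
  qed
  have "{u, v} \<in> edges square_lattice \<longleftrightarrow> dist (plane u) (plane v) = 1"
    unfolding square_lattice_def ugraph.simps mem_Collect_eq doubleton_eq_iff by (metis dist_commute)
  then show ?thesis by (simp only: *)
qed

lemma lattice_edge_cases:
  assumes "{u, v} \<in> edges square_lattice"
  shows "v = u + (1, 0) \<or> v = u + (-1, 0) \<or> v = u + (0, 1) \<or> v = u + (0, -1)"
  using assms unfolding lattice_edge by (cases u; cases v) (auto simp: abs_if split: if_splits)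

lemma lattice_edges_form: "e \<in> edges square_lattice \<Longrightarrow> \<exists>u v. u \<noteq> v \<and> e = {u, v}"
  by (auto simp: square_lattice_def) (metis dist_self zero_neq_one)

abbreviation Uverts :: "point set" where "Uverts \<equiv> {(x, y). y \<ge> 1 \<or> (y = 0 \<and> x \<le> 0)}"

lemma Uinf_simps: "verts Uinf = Uverts" "edges Uinf = {e \<in> edges square_lattice. e \<subseteq> Uverts}"
  by (simp_all add: Uinf_def induced_subgraph_def square_lattice_def)

lemma adj_Uinf: "adj Uinf u v \<longleftrightarrow> \<bar>fst u - fst v\<bar> + \<bar>snd u - snd v\<bar> = 1 \<and> u \<in> Uverts \<and> v \<in> Uverts"
  by (simp add: adj_def Uinf_simps lattice_edge)

lemma walk_Uinf_length:
  "p \<noteq> [] \<Longrightarrow> successively (adj Uinf) p \<Longrightarrow>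
    \<bar>fst (last p) - fst (hd p)\<bar> + \<bar>snd (last p) - snd (hd p)\<bar> \<le> int (length p - 1)"
proof (induction p)
  case (Cons u p)
  show ?case
  proof (cases "p = []")
    case False
    have s: "successively (adj Uinf) p" "adj Uinf u (hd p)"
      using Cons.prems False by (auto simp: successively_Cons)
    have IH: "\<bar>fst (last p) - fst (hd p)\<bar> + \<bar>snd (last p) - snd (hd p)\<bar> \<le> int (length p - 1)"
      by (rule Cons.IH[OF False s(1)])
    have step: "\<bar>fst u - fst (hd p)\<bar> + \<bar>snd u - snd (hd p)\<bar> = 1"
      using s(2) by (simp add: adj_Uinf)
    have "int (length p - 1) + 1 = int (length p)" using False by (cases p) auto
    with IH step False show ?thesis by simp
  qed simp
qed simp

text \<open>
  The distance in the graph is at least the distance in the taxicab norm.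
\<close>
lemma edge_distance_Uinf_ge:
  assumes "edge_distance Uinf (0, 0) (x, y) \<le> enat k"
  shows "\<bar>x\<bar> + \<bar>y\<bar> \<le> int k"
proof -
  have "enat (nat (\<bar>x\<bar> + \<bar>y\<bar>)) \<le> edge_distance Uinf (0, 0) (x, y)"
    unfolding edge_distance_def
  proof (rule INF_greatest)
    fix p assume "p \<in> {p. walk Uinf (0, 0) p (x, y)}"
    then show "enat (nat (\<bar>x\<bar> + \<bar>y\<bar>)) \<le> enat (length p - 1)"
      using walk_Uinf_length[of p] by (auto simp: walk_def)
  qed
  then have "enat (nat (\<bar>x\<bar> + \<bar>y\<bar>)) \<le> enat k" using assms by (rule order_trans)
  then show ?thesis by simp
qed

lemma edge_distance_le:
  assumes "walk G u p v" "length p - 1 \<le> k"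
  shows "edge_distance G u v \<le> enat k"
  unfolding edge_distance_def using assms
  by (intro order_trans[OF INF_lower[of p]]) auto

lemma Utilde_simps:
  "verts (Utilde k) = {v \<in> Uverts. edge_distance Uinf (0, 0) v \<le> enat k}"
  "adj (Utilde k) u v \<longleftrightarrow> adj Uinf u v \<and> u \<in> verts (Utilde k) \<and> v \<in> verts (Utilde k)"
  by (auto simp: Utilde_def induced_subgraph_def Uinf_simps adj_def)

lemma Ugraph_simps:
  "verts (Ugraph k) = {v \<in> verts (Utilde k). vertex_degree (Utilde k) v \<noteq> 1}"
  "adj (Ugraph k) u v \<longleftrightarrow> adj Uinf u v \<and> u \<in> verts (Ugraph k) \<and> v \<in> verts (Ugraph k)"
proof -
  show "verts (Ugraph k) = {v \<in> verts (Utilde k). vertex_degree (Utilde k) v \<noteq> 1}"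
    by (auto simp: Ugraph_def induced_subgraph_def)
  then show "adj (Ugraph k) u v \<longleftrightarrow> adj Uinf u v \<and> u \<in> verts (Ugraph k) \<and> v \<in> verts (Ugraph k)"
    using Utilde_simps(2)[of k u v] by (auto simp: adj_def Ugraph_def induced_subgraph_def)
qed

lemma Ugraph_vertI:
  assumes "v \<in> verts (Utilde k)" "adj (Utilde k) v s" "adj (Utilde k) v t" "s \<noteq> t"
  shows "v \<in> verts (Ugraph k)"
proof -
  have "s \<in> neighbours (Utilde k) v" "t \<in> neighbours (Utilde k) v"
    using assms by (simp_all add: neighbours_def)
  then have "vertex_degree (Utilde k) v \<noteq> 1"
    unfolding vertex_degree_def using assms(4) by (auto simp: card_1_singleton_iff)
  then show ?thesis using assms(1) by (simp add: Ugraph_simps(1))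
qed

lemma axis_distance: "edge_distance Uinf (0, 0) (0, int j) \<le> enat j"
proof (rule edge_distance_le)
  let ?p = "map (\<lambda>i. (0, int i)) [0..<Suc j]"
  have p: "?p ! i = (0, int i)" if "i < Suc j" for i
    using that by (simp del: upt_Suc)
  have "hd ?p = (0, 0)" using p[of 0] by (subst hd_conv_nth) (simp_all del: upt_Suc)
  moreover have "last ?p = (0, int j)" using p[of j] by (subst last_conv_nth) (simp_all del: upt_Suc)
  ultimately show "walk Uinf (0, 0) ?p (0, int j)"
    unfolding walk_def
    by (auto simp: Uinf_simps successively_conv_nth adj_Uinf
      simp del: upt_Suc)
qed simp

lemma square_in_Utilde:
  assumes "k \<ge> 2"
  shows "(0, 0) \<in> verts (Utilde k)" "(-1, 0) \<in> verts (Utilde k)"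
    "(0, 1) \<in> verts (Utilde k)" "(-1, 1) \<in> verts (Utilde k)"
proof -
  have "walk Uinf (0, 0) [(0, 0)] (0, 0)" "walk Uinf (0, 0) [(0, 0), (-1, 0)] (-1, 0)"
    "walk Uinf (0, 0) [(0, 0), (0, 1)] (0, 1)" "walk Uinf (0, 0) [(0, 0), (0, 1), (-1, 1)] (-1, 1)"
    by (simp_all add: walk_def Uinf_simps adj_Uinf)
  from this[THEN edge_distance_le, of k] show "(0, 0) \<in> verts (Utilde k)" "(-1, 0) \<in> verts (Utilde k)"
    "(0, 1) \<in> verts (Utilde k)" "(-1, 1) \<in> verts (Utilde k)"
    using assms by (simp_all add: Utilde_simps(1))
qed

lemma square_in_Ugraph:
  assumes "k \<ge> 2"
  shows "(0, 0) \<in> verts (Ugraph k)" "(-1, 0) \<in> verts (Ugraph k)"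
    "(0, 1) \<in> verts (Ugraph k)" "(-1, 1) \<in> verts (Ugraph k)"
  using square_in_Utilde[OF assms]
    Ugraph_vertI[of "(0, 0)" k "(-1, 0)" "(0, 1)"] Ugraph_vertI[of "(-1, 0)" k "(0, 0)" "(-1, 1)"]
    Ugraph_vertI[of "(0, 1)" k "(0, 0)" "(-1, 1)"] Ugraph_vertI[of "(-1, 1)" k "(-1, 0)" "(0, 1)"]
  by (simp_all add: Utilde_simps(2) adj_Uinf)

text \<open>
  So \<open>U(k)\<close> grows without bound, which makes the maximum in the definition of \<open>d\<^sub>v\<close> a maximum over a finite set.
\<close>
lemma axis_in_Ugraph:
  assumes "1 \<le> j" "j < k"
  shows "(0, int j) \<in> verts (Ugraph k)"
proof -
  have v: "(0, int i) \<in> verts (Utilde k)" if "i \<le> k" for i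
    using order_trans[OF axis_distance[of i], of "enat k"] that by (auto simp: Utilde_simps(1))
  show ?thesis
    by (rule Ugraph_vertI[of _ _ "(0, int (j - 1))" "(0, int (j + 1))"])
      (use v[of j] v[of "j - 1"] v[of "j + 1"] assms in \<open>auto simp: Utilde_simps(2) adj_Uinf of_nat_diff\<close>)
qed

lemma neighbours_origin:
  assumes "k \<ge> 2"
  shows "neighbours (Ugraph k) (0, 0) = {(-1, 0), (0, 1)}"
  using square_in_Ugraph[OF assms]
  by (auto simp: neighbours_def Ugraph_simps(2) adj_Uinf abs_if split: if_splits)

lemma finite_neighbours_Ugraph: "finite (neighbours (Ugraph k) x)"
proof (rule finite_subset)
  show "neighbours (Ugraph k) x \<subseteq> {x + (1, 0), x + (-1, 0), x + (0, 1), x + (0, -1)}"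
    using lattice_edge_cases[of x] by (auto simp: neighbours_def Ugraph_simps(2) adj_Uinf lattice_edge)
qed simp

text \<open>
  The ball of radius 2 has seven vertices, and the three of them at distance 2 other than \<open>(-1, 1)\<close> are
  leaves.
\<close>
lemma verts_Ugraph_2: "verts (Ugraph 2) \<subseteq> {(0, 0), (-1, 0), (0, 1), (-1, 1)}"
proof
  fix v assume v: "v \<in> verts (Ugraph 2)"
  obtain x y where xy: "v = (x, y)" by (cases v)
  have vt: "(x, y) \<in> verts (Utilde 2)" using v xy by (simp add: Ugraph_simps(1))
  have small: "\<bar>s\<bar> + \<bar>t\<bar> \<le> 2" if "(s, t) \<in> verts (Utilde 2)" for s t
    using that edge_distance_Uinf_ge[of s t 2] by (simp add: Utilde_simps(1))
  have U: "(s, t) \<in> verts (Utilde 2) \<Longrightarrow> t \<ge> 1 \<or> t = 0 \<and> s \<le> 0" for s t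
    by (simp add: Utilde_simps(1))
  have leaf: False if w: "w \<in> verts (Utilde 2)" "adj Uinf (x, y) w"
    and only: "\<And>z. z \<in> verts (Utilde 2) \<Longrightarrow> adj Uinf (x, y) z \<Longrightarrow> z = w" for w
  proof -
    have "neighbours (Utilde 2) (x, y) = {w}"
      unfolding neighbours_def Utilde_simps(2) using w only vt by blast
    then show False using v xy by (simp add: Ugraph_simps(1) vertex_degree_def)
  qed
  note sq = square_in_Utilde[of 2, simplified]
  have far: False if far: "\<bar>x\<bar> + \<bar>y\<bar> = 2" "x = 0 \<or> y = 0 \<or> x = 1"
  proof -
    have "(x, y) = (-2, 0) \<or> (x, y) = (0, 2) \<or> (x, y) = (1, 1)"
      using far U[OF vt] by auto
    then show False
    proof (elim disjE)
      assume "(x, y) = (-2, 0)"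
      then show False
        by (intro leaf[of "(-1, 0)"]) (use sq in \<open>auto simp: adj_Uinf dest!: small\<close>)
    next
      assume "(x, y) = (0, 2)"
      then show False
        by (intro leaf[of "(0, 1)"]) (use sq in \<open>auto simp: adj_Uinf dest!: small\<close>)
    next
      assume "(x, y) = (1, 1)"
      then show False
        by (intro leaf[of "(0, 1)"]) (use sq in \<open>auto simp: adj_Uinf dest!: small\<close>)
    qed
  qed
  have "x \<in> {-2..2}" "y \<in> {0..2}" using small[OF vt] U[OF vt] by auto
  then have "x \<in> {-2, -1, 0, 1, 2}" "y \<in> {0, 1, 2}" by auto
  then show "v \<in> {(0, 0), (-1, 0), (0, 1), (-1, 1)}"
    using far small[OF vt] U[OF vt] xy by auto
qed

lemma adj_Ugraph_square:
  assumes "k \<ge> 2"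
  shows "adj (Ugraph k) (0, 0) (-1, 0)" "adj (Ugraph k) (0, 0) (0, 1)"
    "adj (Ugraph k) (0, 1) (-1, 1)" "adj (Ugraph k) (-1, 1) (-1, 0)"
  using square_in_Ugraph[OF assms] by (auto simp: Ugraph_simps(2) adj_Uinf)

lemma Eprob_gt_half:
  assumes "k \<ge> 2"
  shows "Eprob k > 1 / 2"
  using hit_prob_gt[OF finite_neighbours_Ugraph adj_Ugraph_square(1,2,3,4)[OF assms]]
  by (simp add: Eprob_def neighbours_origin[OF assms])

lemma Fval_ge_1:
  assumes "k \<ge> 2"
  shows "Fval k \<ge> 1"
  using Eprob_gt_half[OF assms] by (simp add: Fval_def field_simps)

text \<open>
  With \<open>p\<close> the proportion of bases of \<open>E\<close> that contain the edge from \<open>v\<close> to its left neighbour, the previous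
  results give \<open>2 E(k) p \<le> 1\<close>; the bases without that edge are bases of \<open>E\<close> minus the edge.
\<close>
lemma Fval_bound:
  assumes k: "k \<ge> 2" and E: "edge_set E" and sub: "\<And>e. e \<in> edges (Ugraph k) \<Longrightarrow> (\<lambda>u. u + v) ` e \<in> E"
  shows "real (card (bases E)) \<le> Fval k * real (card (bases (E - {{v, v + (-1, 0)}})))"
proof -
  let ?U = "edges (Ugraph k)" and ?e = "{v, v + (-1, 0)}"
  let ?j = "\<lambda>u::point. u + v"
  have inj: "inj ?j" by (simp add: inj_def)
  have form: "\<exists>u v. u \<noteq> v \<and> e = {u, v}" if "e \<in> ?U" for e
    using that lattice_edges_form by (auto simp: Ugraph_def Utilde_def induced_subgraph_def Uinf_simps)
  have "finite ?U"
  proof (rule finite_imageD)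
    show "finite ((`) ?j ` ?U)" using E sub by (auto simp: edge_set_def intro: finite_subset[of _ E])
    show "inj_on ((`) ?j) ?U" using inj by (meson inj_image_eq_iff inj_onI)
  qed
  then have U: "edge_set ?U" using form by (simp add: edge_set_def)
  have ab: "{(0, 0), (-1, 0)} \<in> ?U" using adj_Ugraph_square(1)[OF k] by (simp add: adj_def)
  obtain f where f: "voltage ?U (0, 0) (-1, 0) f" using tree_voltage[OF U ab] by blast
  define S where "S = (\<Sum>y\<in>nbs ?U (0, 0). f y)"
  define M where "M = real (card {B \<in> bases E. ?e \<in> B})"
  have N: "nbs ?U (0, 0) = {(-1, 0), (0, 1)}" using neighbours_origin[OF k] by (simp add: neighbours_eq_nbs)
  have "Eprob k \<le> S / 2"
    using hit_prob_le_voltage[OF U f ab] by (simp add: Eprob_def N S_def)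
  moreover have "S * M \<le> real (card (bases E))"
  proof -
    have "(0, 0) + v = v" "(-1, 0) + v = v + (-1, 0)" by (cases v; simp)+
    then show ?thesis using rayleigh[OF U ab f E inj sub] by (simp only: S_def M_def)
  qed
  moreover have "M \<ge> 0" by (simp add: M_def)
  ultimately have EM: "2 * Eprob k * M \<le> real (card (bases E))"
    using mult_right_mono[of "2 * Eprob k" S M] by linarith
  have fin: "finite (bases E)" using E by (simp add: edge_set_def finite_bases)
  have "bases E = {B \<in> bases E. ?e \<in> B} \<union> {B \<in> bases E. ?e \<notin> B}" by auto
  then have "card (bases E) = card {B \<in> bases E. ?e \<in> B} + card {B \<in> bases E. ?e \<notin> B}"
    using fin card_Un_disjoint[of "{B \<in> bases E. ?e \<in> B}" "{B \<in> bases E. ?e \<notin> B}"] by auto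
  then have split: "real (card (bases E)) - M \<le> real (card (bases (E - {?e})))"
    using card_bases_delete[of E ?e] E by (simp add: M_def edge_set_def)
  have half: "2 * Eprob k - 1 > 0" using Eprob_gt_half[OF k] by simp
  have "(2 * Eprob k - 1) * real (card (bases E)) \<le> 2 * Eprob k * (real (card (bases E)) - M)"
    using EM by (simp add: algebra_simps)
  also have "\<dots> \<le> 2 * Eprob k * real (card (bases (E - {?e})))"
    using split half by (intro mult_left_mono) auto
  finally show ?thesis using half by (simp add: Fval_def field_simps)
qed

section \<open>The unit square cut off by a corner\<close>

text \<open>
  A filled curve has no holes: its complement is connected and unbounded, so no curve in it can enclose a point of the complement.
\<close>
lemma inside_subset_filled:
  fixes L C :: "complex set"
  assumes "compact L" "bounded C" "C \<subseteq> L \<union> inside L"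
  shows "inside C \<subseteq> L \<union> inside L"
proof -
  have K: "L \<union> inside L = - outside L" by (rule union_with_inside)
  have "bounded L" using assms(1) compact_imp_bounded by blast
  then have con: "connected (outside L)" and unb: "\<not> bounded (outside L)"
    by (simp_all add: connected_outside unbounded_outside)
  have dis: "C \<inter> outside L = {}" using assms(3) unfolding K by blast
  have "inside C \<inter> outside L = {}"
  proof (rule ccontr)
    assume ne: "inside C \<inter> outside L \<noteq> {}"
    have "outside C \<inter> outside L = {}"
      using inside_outside_intersect_connected[OF con ne] dis by blast
    then have "outside L \<subseteq> inside C" using dis inside_Un_outside[of C] by blast
    then show False using unb bounded_inside[OF assms(2)] bounded_subset by blast
  qed
  then show ?thesis unfolding K by blast
qed

lemma connected_unbounded_outside:
  fixes C T :: "complex set"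
  assumes "bounded C" "connected T" "\<not> bounded T" "C \<inter> T = {}"
  shows "T \<subseteq> outside C"
proof -
  have "outside C \<inter> T \<noteq> {}"
  proof
    assume "outside C \<inter> T = {}"
    then have "T \<subseteq> inside C" using assms(4) inside_Un_outside[of C] by blast
    then show False using assms(3) bounded_inside[OF assms(1)] bounded_subset by blast
  qed
  then have "inside C \<inter> T = {}" using inside_outside_intersect_connected[OF assms(2)] assms(4) by blast
  then show ?thesis using assms(4) inside_Un_outside[of C] by blast
qed

lemma unbounded_lower_half_plane: "\<not> bounded {z. Im z < y}"
proof
  assume "bounded {z. Im z < y}"
  then obtain B where B: "\<And>z. Im z < y \<Longrightarrow> cmod z \<le> B" by (auto simp: bounded_iff)
  have "cmod (Complex 0 (y - \<bar>y\<bar> - \<bar>B\<bar> - 1)) \<le> B" by (rule B) simp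
  then have "\<bar>y - \<bar>y\<bar> - \<bar>B\<bar> - 1\<bar> \<le> B" by (simp add: cmod_def)
  then show False by linarith
qed

text \<open>
  The arc \<open>g\<close> and two sides of the unit square form a Jordan curve with a corner at \<open>v\<close>.  Near the corner
  the curve is just the two sides.  Of the two sectors that they leave, the large one can be joined
  to the half plane below the curve and is therefore outside.  But \<open>v\<close> lies in the boundary of the
  inside, so the small sector, and with it the square, is inside.
\<close>
lemma corner_square_inside:
  fixes x y :: real
  defines "v \<equiv> Complex x y" and "l \<equiv> Complex (x - 1) y" and "u \<equiv> Complex x (y + 1)"
  assumes g: "arc g" "pathstart g = l" "pathfinish g = u"
    and above: "\<And>z. z \<in> path_image g \<Longrightarrow> Im z \<ge> y"
    and row: "\<And>z. z \<in> path_image g \<Longrightarrow> Im z = y \<Longrightarrow> Re z \<le> x - 1"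
    and col: "\<And>z. z \<in> path_image g \<Longrightarrow> Re z = x \<Longrightarrow> Im z \<ge> y + 1"
    and box: "path_image g \<inter> box l u = {}"
  defines "C \<equiv> path_image g \<union> (closed_segment u v \<union> closed_segment v l)"
  shows "cbox l u \<subseteq> C \<union> inside C" "compact C"
proof -
  have coord: "Re u = x" "Im u = y + 1" "Re v = x" "Im v = y" "Re l = x - 1" "Im l = y"
    by (simp_all add: u_def v_def l_def)
  have seg_uv: "z \<in> closed_segment u v \<longleftrightarrow> Re z = x \<and> y \<le> Im z \<and> Im z \<le> y + 1" for z
    unfolding u_def v_def by (subst closed_segment_same_Re) (auto simp: closed_segment_eq_real_ivl)
  have seg_vl: "z \<in> closed_segment v l \<longleftrightarrow> Im z = y \<and> x - 1 \<le> Re z \<and> Re z \<le> x" for z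
    unfolding l_def v_def by (subst closed_segment_same_Im) (auto simp: closed_segment_eq_real_ivl)
  have in_box: "z \<in> box l u \<longleftrightarrow> x - 1 < Re z \<and> Re z < x \<and> y < Im z \<and> Im z < y + 1" for z
    by (auto simp: in_box_complex_iff l_def u_def)
  define h where "h = linepath u v +++ linepath v l"
  have him: "path_image h = closed_segment u v \<union> closed_segment v l"
    unfolding h_def by (subst path_image_join) auto
  have "arc h"
    unfolding h_def
  proof (rule arc_join)
    show "arc (linepath u v)" "arc (linepath v l)" by (auto simp: coord complex_eq_iff intro!: arc_linepath)
    show "path_image (linepath u v) \<inter> path_image (linepath v l) \<subseteq> {pathstart (linepath v l)}"
      by (auto simp: seg_uv seg_vl coord complex_eq_iff)
  qed simp
  have "simple_path (g +++ h)"
  proof (rule simple_path_join_loop[OF g(1) \<open>arc h\<close>])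
    show "pathfinish g = pathstart h" "pathfinish h = pathstart g" using g by (simp_all add: h_def)
    show "path_image g \<inter> path_image h \<subseteq> {pathstart g, pathstart h}"
    proof
      fix z assume z: "z \<in> path_image g \<inter> path_image h"
      then have zg: "z \<in> path_image g" by simp
      from z have "z \<in> closed_segment u v \<or> z \<in> closed_segment v l" by (simp add: him)
      then show "z \<in> {pathstart g, pathstart h}"
      proof
        assume "z \<in> closed_segment u v"
        then have "z = u" using col[OF zg] by (auto simp: seg_uv coord complex_eq_iff)
        then show ?thesis by (simp add: h_def)
      next
        assume "z \<in> closed_segment v l"
        then have "z = l" using row[OF zg] by (auto simp: seg_vl coord complex_eq_iff)
        then show ?thesis by (simp add: g)
      qed
    qed
  qed
  moreover have "pathfinish (g +++ h) = pathstart (g +++ h)" using g by (simp add: h_def)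
  moreover have "path_image (g +++ h) = C"
    using g by (subst path_image_join) (simp_all add: h_def[symmetric] him C_def, simp add: h_def)
  ultimately have fr: "frontier (inside C) = C" using Jordan_inside_outside[of "g +++ h"] by simp
  show cC: "compact C"
    unfolding C_def by (intro compact_Un compact_arc_image g) auto
  then have bC: "bounded C" and clC: "closed C" by (simp_all add: compact_imp_bounded compact_imp_closed)
  have "v \<notin> path_image g" using row[of v] by (auto simp: coord)
  moreover have "closed (path_image g)" using g(1) by (simp add: closed_arc_image)
  ultimately obtain r0 where "r0 > 0" and r0: "ball v r0 \<subseteq> - path_image g"
    using open_contains_ball[of "- path_image g"] by (auto simp: open_Compl)
  \<comment> \<open>within distance \<open>r\<close> of \<open>v\<close> only the two sides of the square are left; the bound 1 is their length\<close>
  define r where "r = min r0 1"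
  have r: "0 < r" "r \<le> 1" "ball v r \<subseteq> - path_image g" using \<open>r0 > 0\<close> r0 by (auto simp: r_def)
  have low: "{w. Im w < y} \<subseteq> outside C"
  proof (rule connected_unbounded_outside[OF bC])
    show "connected {w. Im w < y}" by (intro convex_connected convex_halfspace_Im_lt)
    show "C \<inter> {w. Im w < y} = {}" using above by (fastforce simp: C_def seg_uv seg_vl)
  qed (rule unbounded_lower_half_plane)
  have "v \<in> frontier (inside C)" unfolding fr by (simp add: C_def)
  then have "v \<in> closure (inside C)" by (simp add: frontier_def)
  then obtain z where z: "z \<in> inside C" "dist z v < r" using r(1) by (auto simp: closure_approachable)
  have zC: "z \<notin> C" "z \<notin> outside C" using z(1) inside_Int_outside[of C] inside_no_overlap[of C] by blast+
  have zv: "\<bar>Re z - x\<bar> < 1" "\<bar>Im z - y\<bar> < 1"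
    using abs_Re_le_cmod[of "z - v"] abs_Im_le_cmod[of "z - v"] z(2) r(2) by (simp_all add: dist_norm coord)
  have "Im z \<ge> y" using low zC by force
  moreover have "Re z \<le> x"
  proof (rule ccontr)
    assume right: "\<not> Re z \<le> x"
    \<comment> \<open>from \<open>z\<close> straight down to the lower half plane, missing the curve\<close>
    let ?w = "Complex (Re z) (y - 1)"
    let ?T = "closed_segment z ?w"
    have T: "w \<in> ?T \<longleftrightarrow> Re w = Re z \<and> y - 1 \<le> Im w \<and> Im w \<le> Im z" for w
      by (subst closed_segment_same_Re) (use \<open>Im z \<ge> y\<close> in \<open>auto simp: closed_segment_eq_real_ivl\<close>)
    have "?w \<in> outside C" by (rule subsetD[OF low]) simp
    then have out: "outside C \<inter> ?T \<noteq> {}" by (meson disjoint_iff ends_in_segment(2))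
    have ins: "inside C \<inter> ?T \<noteq> {}" using z(1) by (meson disjoint_iff ends_in_segment(1))
    have "C \<inter> ?T \<noteq> {}" by (rule inside_outside_intersect_connected[OF connected_segment(1) ins out])
    then obtain w where w: "w \<in> C" "Re w = Re z" "Im w \<le> Im z" using T by auto
    then have wg: "w \<in> path_image g" using right by (auto simp: C_def seg_uv seg_vl)
    have "cmod (w - v) \<le> cmod (z - v)"
      unfolding cmod_def using above[OF wg] w by (auto simp: coord intro!: power_mono)
    then have "w \<in> ball v r" using z(2) by (simp add: dist_norm norm_minus_commute)
    then show False using r(3) wg by auto
  qed
  moreover have "Re z \<noteq> x" using zC(1) zv \<open>Im z \<ge> y\<close> by (auto simp: C_def seg_uv)
  moreover have "Im z \<noteq> y" using zC(1) zv \<open>Re z \<le> x\<close> by (auto simp: C_def seg_vl)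
  ultimately have zbox: "z \<in> box l u" using zv by (auto simp: in_box)
  have Cbox: "C \<inter> box l u = {}" using box by (auto simp: C_def seg_uv seg_vl in_box)
  have "inside C \<inter> box l u \<noteq> {}" using z(1) zbox by blast
  then have "outside C \<inter> box l u = {}"
    using inside_outside_intersect_connected[OF convex_connected[OF convex_box(2)]] Cbox by metis
  then have "box l u \<subseteq> inside C" using Cbox inside_Un_outside[of C] by blast
  then have "closure (box l u) \<subseteq> closure (inside C)" by (rule closure_mono)
  moreover have "closure (box l u) = cbox l u" using zbox by (intro closure_box) blast
  moreover have "closure (inside C) \<subseteq> C \<union> inside C" by (rule closure_inside_subset[OF clC])
  ultimately show "cbox l u \<subseteq> C \<union> inside C" by blast
qed

lemma lattice_segment:
  assumes "{s, t} \<in> edges square_lattice" "z \<in> closed_segment (plane s) (plane t)"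
  obtains n m :: int where "{s, t} = {(n, m), (n + 1, m)}" "Im z = m" "n \<le> Re z" "Re z \<le> n + 1"
    | n m :: int where "{s, t} = {(n, m), (n, m + 1)}" "Re z = n" "m \<le> Im z" "Im z \<le> m + 1"
proof -
  have hor: "Im z = m \<and> n \<le> Re z \<and> Re z \<le> n + 1"
    if "z \<in> closed_segment (plane (n, m)) (plane (n + 1, m))" for n m :: int
    using that by (simp add: plane_def closed_segment_same_Im closed_segment_eq_real_ivl)
  have ver: "Re z = n \<and> m \<le> Im z \<and> Im z \<le> m + 1"
    if "z \<in> closed_segment (plane (n, m)) (plane (n, m + 1))" for n m :: int
    using that by (simp add: plane_def closed_segment_same_Re closed_segment_eq_real_ivl)
  obtain a b where s: "s = (a, b)" by (cases s)
  have z': "z \<in> closed_segment (plane t) (plane s)" using assms(2) by (simp add: closed_segment_commute)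
  from lattice_edge_cases[OF assms(1)] show thesis
  proof (elim disjE)
    assume "t = s + (1, 0)"
    then show thesis using that(1)[of a b] hor[of a b] assms(2) s by simp
  next
    assume "t = s + (-1, 0)"
    then show thesis using that(1)[of "a - 1" b] hor[of "a - 1" b] z' s by (simp add: insert_commute)
  next
    assume "t = s + (0, 1)"
    then show thesis using that(2)[of a b] ver[of a b] assms(2) s by simp
  next
    assume "t = s + (0, -1)"
    then show thesis using that(2)[of a "b - 1"] ver[of a "b - 1"] z' s by (simp add: insert_commute)
  qed
qed

text \<open>
  The position, relative to \<open>v\<close>, of the edges drawn between vertices that come before \<open>v\<close>: exactly the hypotheses of
  \<open>corner_square_inside\<close>.
\<close>
lemma earlier_segment:
  assumes e: "{s, t} \<in> edges square_lattice" and z: "z \<in> closed_segment (plane s) (plane t)"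
    and page: "page_le s v" "page_le t v" "s \<noteq> v" "t \<noteq> v"
  shows "Im z \<ge> real_of_int (snd v)" "Im z = real_of_int (snd v) \<Longrightarrow> Re z \<le> real_of_int (fst v) - 1" "Re z = real_of_int (fst v) \<Longrightarrow> Im z \<ge> real_of_int (snd v) + 1"
    "\<not> (real_of_int (fst v) - 1 < Re z \<and> Re z < real_of_int (fst v) \<and> real_of_int (snd v) < Im z \<and> Im z < real_of_int (snd v) + 1)"
proof -
  obtain a b where v: "v = (a, b)" by (cases v)
  have "Im z \<ge> b \<and> (Im z = b \<longrightarrow> Re z \<le> a - 1) \<and> (Re z = a \<longrightarrow> Im z \<ge> b + 1)
      \<and> \<not> (a - 1 < Re z \<and> Re z < a \<and> b < Im z \<and> Im z < b + 1)"
  proof (rule lattice_segment[OF e z])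
    fix n m :: int
    assume st: "{s, t} = {(n, m), (n + 1, m)}" and z: "Im z = m" "n \<le> Re z" "Re z \<le> n + 1"
    have "m > b \<or> m = b \<and> n + 1 \<le> a - 1"
      using st page v by (auto simp: page_le_def doubleton_eq_iff)
    then have "real_of_int m \<ge> b + 1 \<or> m = b \<and> real_of_int n + 1 \<le> a - 1" by linarith
    then show ?thesis using z by auto
  next
    fix n m :: int
    assume st: "{s, t} = {(n, m), (n, m + 1)}" and z: "Re z = n" "m \<le> Im z" "Im z \<le> m + 1"
    have "m > b \<or> m = b \<and> n \<le> a - 1"
      using st page v by (auto simp: page_le_def doubleton_eq_iff)
    then have "real_of_int m \<ge> b + 1 \<or> m = b \<and> real_of_int n \<le> a - 1" by linarith
    moreover have "n \<le> a - 1 \<or> n \<ge> a" by linarith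
    then have "real_of_int n \<le> a - 1 \<or> real_of_int n \<ge> a" by linarith
    ultimately show ?thesis using z by auto
  qed
  then show "Im z \<ge> real_of_int (snd v)" "Im z = real_of_int (snd v) \<Longrightarrow> Re z \<le> real_of_int (fst v) - 1" "Re z = real_of_int (fst v) \<Longrightarrow> Im z \<ge> real_of_int (snd v) + 1"
    "\<not> (real_of_int (fst v) - 1 < Re z \<and> Re z < real_of_int (fst v) \<and> real_of_int (snd v) < Im z \<and> Im z < real_of_int (snd v) + 1)"
    by (simp_all add: v)
qed

definition drawing :: "point set set \<Rightarrow> complex set" where
  "drawing F = {z. \<exists>s t. {s, t} \<in> F \<and> z \<in> closed_segment (plane s) (plane t)}"

lemma conn_path_component:
  assumes "(u, w) \<in> conn F"
  shows "u = w \<or> path_component (drawing F) (plane u) (plane w)"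
  using assms unfolding conn_def
proof (induction rule: rtrancl_induct)
  case (step w w')
  have "closed_segment (plane w) (plane w') \<subseteq> drawing F"  using step.hyps(2) by (auto simp only: drawing_def arcs_iff)
  then have "path_component (drawing F) (plane w) (plane w')"
    by (rule path_component_linepath)
  then show ?case using step.IH path_component_trans by blast
qed simp

lemma compact_loop_curve: "compact (loop_curve \<alpha>)"
  unfolding loop_curve_def by (intro compact_UN) auto

text \<open>
  If the two earlier neighbours of \<open>v\<close> are joined by earlier edges, these contain an arc that closes up to a
  Jordan curve at the corner \<open>v\<close>.  The square is inside this curve, and the curve lies in the filled loop.
\<close>
theorem square_enclosed:
  fixes v :: point
  assumes F: "F \<subseteq> edges square_lattice" "drawing F \<subseteq> loop_region \<alpha>"
    and earlier: "\<And>s. s \<in> \<Union>F \<Longrightarrow> page_le s v \<and> s \<noteq> v"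
    and con: "(v + (-1, 0), v + (0, 1)) \<in> conn F"
    and seg: "closed_segment (plane v) (plane (v + (-1, 0))) \<subseteq> loop_region \<alpha>"
      "closed_segment (plane v) (plane (v + (0, 1))) \<subseteq> loop_region \<alpha>"
  shows "closed_segment (plane (v + (-1, 0))) (plane (v + (-1, 1))) \<subseteq> loop_region \<alpha>"
    "closed_segment (plane (v + (0, 1))) (plane (v + (-1, 1))) \<subseteq> loop_region \<alpha>"
proof -
  obtain a b where v: "v = (a, b)" by (cases v)
  define x y where "x = real_of_int a" and "y = real_of_int b"
  have pl: "plane v = Complex x y" "plane (v + (-1, 0)) = Complex (x - 1) y"
    "plane (v + (0, 1)) = Complex x (y + 1)" "plane (v + (-1, 1)) = Complex (x - 1) (y + 1)"
    by (simp_all add: plane_def v x_def y_def)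
  have "path_component (drawing F) (Complex (x - 1) y) (Complex x (y + 1))"
    using conn_path_component[OF con] unfolding pl by (simp add: v)
  then obtain p where p: "path p" "path_image p \<subseteq> drawing F"
      "pathstart p = Complex (x - 1) y" "pathfinish p = Complex x (y + 1)"
    by (auto simp: path_component_def)
  obtain g where g: "arc g" "path_image g \<subseteq> path_image p"
      "pathstart g = Complex (x - 1) y" "pathfinish g = Complex x (y + 1)"
    using path_contains_arc[OF p(1,3,4)] by auto
  have gF: "path_image g \<subseteq> drawing F" using g(2) p(2) by blast
  have z: "Im z \<ge> y \<and> (Im z = y \<longrightarrow> Re z \<le> x - 1) \<and> (Re z = x \<longrightarrow> Im z \<ge> y + 1)
      \<and> \<not> (x - 1 < Re z \<and> Re z < x \<and> y < Im z \<and> Im z < y + 1)" if zg: "z \<in> path_image g" for z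
  proof -
    obtain s t where st: "{s, t} \<in> F" "z \<in> closed_segment (plane s) (plane t)"
      using subsetD[OF gF zg] unfolding drawing_def by blast
    have e: "{s, t} \<in> edges square_lattice" using st(1) F(1) by blast
    have "page_le s v" "page_le t v" "s \<noteq> v" "t \<noteq> v" using earlier st(1) by blast+
    from earlier_segment[OF e st(2) this] show ?thesis by (simp add: v x_def y_def)
  qed
  let ?C = "path_image g \<union> (closed_segment (Complex x (y + 1)) (Complex x y) \<union>
     closed_segment (Complex x y) (Complex (x - 1) y))"
  have "path_image g \<inter> box (Complex (x - 1) y) (Complex x (y + 1)) = {}"
    using z by (auto simp: in_box_complex_iff)
  then have C: "cbox (Complex (x - 1) y) (Complex x (y + 1)) \<subseteq> ?C \<union> inside ?C" "compact ?C"
    using z by (intro corner_square_inside[OF g(1,3,4)]; simp)+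
  have sub: "?C \<subseteq> loop_region \<alpha>"
    using gF F(2) seg unfolding pl by (auto simp: closed_segment_commute)
  have "inside ?C \<subseteq> loop_region \<alpha>"
    unfolding loop_region_def
    by (rule inside_subset_filled[OF compact_loop_curve compact_imp_bounded[OF C(2)]])
      (use sub in \<open>simp add: loop_region_def\<close>)
  then have box: "cbox (Complex (x - 1) y) (Complex x (y + 1)) \<subseteq> loop_region \<alpha>" using C(1) sub by blast
  have "closed_segment w z \<subseteq> loop_region \<alpha>"
    if "w \<in> cbox (Complex (x - 1) y) (Complex x (y + 1))" "z \<in> cbox (Complex (x - 1) y) (Complex x (y + 1))" for w z
    using closed_segment_subset[OF that convex_box(1)] box by (rule subset_trans)
  note box_segment = this[unfolded in_cbox_complex_iff complex.sel]
  show "closed_segment (plane (v + (-1, 0))) (plane (v + (-1, 1))) \<subseteq> loop_region \<alpha>"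
    "closed_segment (plane (v + (0, 1))) (plane (v + (-1, 1))) \<subseteq> loop_region \<alpha>"
    unfolding pl by (rule box_segment; simp)+
qed

section \<open>Spanning trees and bases\<close>

lemma successively_conn:
  "p \<noteq> [] \<Longrightarrow> successively (\<lambda>x y. {x, y} \<in> F) p \<Longrightarrow> (hd p, last p) \<in> conn F"
proof (induction p)
  case (Cons u p)
  show ?case
  proof (cases "p = []")
    case False
    then have "{u, hd p} \<in> F" "(hd p, last p) \<in> conn F" using Cons by (auto simp: successively_Cons)
    then show ?thesis using False conn_trans[OF conn_edge] by auto
  qed simp
qed simp

text \<open>
  Loops are cut out: a vertex that the path visits already is followed only from that visit on.
\<close>
lemma conn_distinct_path:
  assumes "(u, v) \<in> conn F"
  shows "\<exists>p. p \<noteq> [] \<and> distinct p \<and> hd p = u \<and> last p = v \<and> set p \<subseteq> insert v (\<Union>F)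
    \<and> successively (\<lambda>x y. {x, y} \<in> F) p"
  using assms unfolding conn_def
proof (induction rule: converse_rtrancl_induct)
  case base
  show ?case by (rule exI[of _ "[v]"]) simp
next
  case (step u w)
  then obtain p where p: "p \<noteq> []" "distinct p" "hd p = w" "last p = v" "set p \<subseteq> insert v (\<Union>F)"
      "successively (\<lambda>x y. {x, y} \<in> F) p" by blast
  show ?case
  proof (cases "u \<in> set p")
    case True
    then obtain xs ys where xs: "p = xs @ u # ys" by (auto simp: in_set_conv_decomp)
    then show ?thesis using p by (intro exI[of _ "u # ys"]) (auto simp: successively_append_iff)
  next
    case False
    then show ?thesis using p step.hyps(1)
      by (intro exI[of _ "u # p"]) (auto simp: successively_Cons)
  qed
qed

text \<open>
  An edge that can be bypassed closes a loop with the shortcut-free bypass, which a tree does not have.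
\<close>
lemma spanning_tree_basis:
  assumes G: "wf_ugraph G" and T: "spanning_tree T G"
  shows "edges T \<in> bases (edges G)"
proof -
  have wf: "wf_ugraph T" and sub: "edges T \<subseteq> edges G" and verts: "verts T = verts G"
    and con: "connected_graph T" and acyc: "\<And>\<alpha>. \<not> simple_closed_loop T \<alpha>"
    using T by (auto simp: spanning_tree_def subgraph_def is_tree_def)
  have inv: "u \<in> verts T \<and> v \<in> verts T \<and> u \<noteq> v" if "{u, v} \<in> edges T" for u v
    using wf that unfolding wf_ugraph_def by (force simp: doubleton_eq_iff)
  have "arcs (edges G) \<subseteq> conn (edges T)"
  proof clarify
    fix u v assume "(u, v) \<in> arcs (edges G)"
    then have "u \<in> verts T" "v \<in> verts T"
      using G unfolding wf_ugraph_def verts by (force simp: doubleton_eq_iff)+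
    then obtain p where "walk T u p v" using con by (auto simp: connected_graph_def)
    then have "p \<noteq> []" "successively (\<lambda>x y. {x, y} \<in> edges T) p" "hd p = u" "last p = v"
      by (auto simp: walk_def adj_def[abs_def])
    then show "(u, v) \<in> conn (edges T)" using successively_conn[of p "edges T"] by simp
  qed
  moreover have "forest (edges T)"
    unfolding forest_def
  proof (intro allI impI notI)
    fix u v assume uv: "{u, v} \<in> edges T" and c: "(u, v) \<in> conn (edges T - {{u, v}})"
    obtain p where p: "p \<noteq> []" "distinct p" "hd p = u" "last p = v"
        "set p \<subseteq> insert v (\<Union>(edges T - {{u, v}}))"
        "successively (\<lambda>x y. {x, y} \<in> edges T - {{u, v}}) p"
      using conn_distinct_path[OF c] by blast
    have "length p > 2"
    proof (rule ccontr)
      assume "\<not> length p > 2"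
      then have "(\<exists>x. p = [x]) \<or> (\<exists>x y. p = [x, y])"
        using p(1) by (cases p; cases "tl p"; auto)
      then show False using p(3,4,6) inv[OF uv] by auto
    qed
    moreover have "set p \<subseteq> verts T"
    proof
      fix x assume "x \<in> set p"
      then have "x = v \<or> (\<exists>e\<in>edges T. x \<in> e)" using p(5) by blast
      then show "x \<in> verts T" using inv[OF uv] wf by (auto simp: wf_ugraph_def)
    qed
    moreover have "successively (adj T) p"
      by (rule successively_mono[OF p(6)]) (simp add: adj_def)
    moreover have "adj T (last p) (hd p)" using uv p(3,4) by (simp add: adj_def insert_commute)
    ultimately have "simple_closed_loop T p" using p(2) by (simp add: simple_closed_loop_def)
    then show False using acyc by blast
  qed
  ultimately show ?thesis using sub by (simp add: bases_def)
qed

lemma num_spanning_trees_le: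
  assumes "wf_ugraph G" "finite (edges G)"
  shows "num_spanning_trees G \<le> card (bases (edges G))"
  unfolding num_spanning_trees_def
proof (rule card_inj_on_le)
  show "inj_on edges {T. spanning_tree T G}"
    by (rule inj_onI) (auto simp: spanning_tree_def intro: ugraph.equality)
  show "edges ` {T. spanning_tree T G} \<subseteq> bases (edges G)"
    using spanning_tree_basis[OF assms(1)] by auto
  show "finite (bases (edges G))" using assms(2) by (rule finite_bases)
qed

section \<open>Building a simple grid graph in reading order\<close>

lemma conn_isolated: "(v, x) \<in> conn F \<Longrightarrow> v \<notin> \<Union>F \<Longrightarrow> x = v"
  unfolding conn_def by (erule converse_rtranclE) auto

lemma page_le_antisym: "page_le u v \<Longrightarrow> page_le v u \<Longrightarrow> u = v"
  by (auto simp: page_le_def prod_eq_iff)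

lemma page_le_trans: "page_le u v \<Longrightarrow> page_le v w \<Longrightarrow> page_le u w"
  by (auto simp: page_le_def)

lemma page_last:
  assumes "finite W" "W \<noteq> {}"
  obtains v where "v \<in> W" "\<And>u. u \<in> W \<Longrightarrow> page_le u v"
proof -
  have "\<exists>v\<in>W. \<forall>u\<in>W. page_le u v"
    using assms
  proof (induction rule: finite_ne_induct)
    case (singleton x)
    then show ?case by (simp add: page_le_def)
  next
    case (insert x F)
    then obtain v where v: "v \<in> F" "\<forall>u\<in>F. page_le u v" by blast
    have "page_le x v \<or> page_le v x" by (auto simp: page_le_def)
    moreover have "page_le x x" by (simp add: page_le_def)
    ultimately show ?case using v page_le_trans by blast
  qed
  then show thesis using that by blast
qed

definition edges_within :: "'a ugraph \<Rightarrow> 'a set \<Rightarrow> 'a set set" where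
  "edges_within G W = {e \<in> edges G. e \<subseteq> W}"

lemma edges_Hgraph: "edges (Hgraph G v) = edges_within G {u. page_le u v}"
  by (simp add: Hgraph_def induced_subgraph_def edges_within_def)

lemma finite_depths:
  assumes "finite (verts G)"
  shows "finite {k. k \<ge> 1 \<and> subgraph (translate_graph v (Ugraph k)) (Hgraph G v)}"
proof (rule finite_subset)
  define f :: "nat \<Rightarrow> point" where "f k = (0, int (k - 1)) + v" for k
  show "{k. k \<ge> 1 \<and> subgraph (translate_graph v (Ugraph k)) (Hgraph G v)}
    \<subseteq> insert 1 (f -` verts G \<inter> {1..})"
  proof
    fix k assume k: "k \<in> {k. k \<ge> 1 \<and> subgraph (translate_graph v (Ugraph k)) (Hgraph G v)}"
    show "k \<in> insert 1 (f -` verts G \<inter> {1..})"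
    proof (cases "k = 1")
      case False
      then have "(0, int (k - 1)) \<in> verts (Ugraph k)" using k by (intro axis_in_Ugraph) auto
      then have "f k \<in> verts (translate_graph v (Ugraph k))"
        by (auto simp: translate_graph_def map_ugraph_def f_def)
      then have "f k \<in> verts G" using k by (auto simp: subgraph_def Hgraph_def induced_subgraph_def)
      then show ?thesis using k by simp
    qed simp
  qed
  have "inj_on f {1..}" by (rule inj_onI) (auto simp: f_def)
  then show "finite (insert 1 (f -` verts G \<inter> {1..}))"
    using assms by (simp add: finite_vimage_IntI)
qed

lemma edges_Ugraph_2:
  assumes "e \<in> edges (Ugraph 2)"
  shows "e \<in> {{(0, 0), (-1, 0)}, {(0, 0), (0, 1)}, {(-1, 0), (-1, 1)}, {(0, 1), (-1, 1)}}"
proof -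
  have "e \<in> edges square_lattice"
    using assms by (auto simp: Ugraph_def Utilde_def induced_subgraph_def Uinf_simps)
  then obtain s t where e: "e = {s, t}" using lattice_edges_form by blast
  have "adj (Ugraph 2) s t" using assms e by (simp add: adj_def)
  then have s: "s \<in> verts (Ugraph 2)" and t: "t \<in> verts (Ugraph 2)"
    and st: "\<bar>fst s - fst t\<bar> + \<bar>snd s - snd t\<bar> = 1"
    by (simp_all add: Ugraph_simps(2) adj_Uinf)
  show ?thesis
    unfolding e using subsetD[OF verts_Ugraph_2 s] subsetD[OF verts_Ugraph_2 t] st
    by (elim insertE emptyE) (simp_all add: doubleton_eq_iff)
qed

lemma square_subgraph:
  fixes v :: point
  assumes wf: "wf_ugraph G"
    and sq: "{v, v + (-1, 0)} \<in> edges G" "{v, v + (0, 1)} \<in> edges G"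
      "{v + (-1, 0), v + (-1, 1)} \<in> edges G" "{v + (0, 1), v + (-1, 1)} \<in> edges G"
  shows "subgraph (translate_graph v (Ugraph 2)) (Hgraph G v)"
proof -
  have inv: "s \<in> verts G \<and> t \<in> verts G" if "{s, t} \<in> edges G" for s t
    using wf that unfolding wf_ugraph_def by (force simp: doubleton_eq_iff)
  obtain a b where v: "v = (a, b)" by (cases v)
  have pages: "page_le v v" "page_le (v + (-1, 0)) v" "page_le (v + (0, 1)) v" "page_le (v + (-1, 1)) v"
    by (simp_all add: page_le_def v)
  have v0: "v + (0, 0) = v" by (simp add: v)
  have H: "{s, t} \<in> edges (Hgraph G v)" if "{s, t} \<in> edges G" "page_le s v" "page_le t v" for s t
    using that by (simp add: edges_Hgraph edges_within_def)
  have img: "(\<lambda>u. u + v) ` {s, t} = {v + s, v + t}" for s t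
    by (simp add: add.commute)
  have e: "(\<lambda>u. u + v) ` e \<in> edges (Hgraph G v)" if "e \<in> edges (Ugraph 2)" for e
  proof -
    have "e = {(0, 0), (-1, 0)} \<or> e = {(0, 0), (0, 1)} \<or> e = {(-1, 0), (-1, 1)} \<or> e = {(0, 1), (-1, 1)}"
      using edges_Ugraph_2[OF that] by simp
    then show ?thesis
      using H[OF sq(1) pages(1,2)] H[OF sq(2) pages(1,3)] H[OF sq(3) pages(2,4)] H[OF sq(4) pages(3,4)]
      by (elim disjE) (simp_all only: img v0)
  qed
  have w: "u + v \<in> verts (Hgraph G v)" if "u \<in> verts (Ugraph 2)" for u
  proof -
    have "v + u \<in> {v, v + (-1, 0), v + (0, 1), v + (-1, 1)}"
      using subsetD[OF verts_Ugraph_2 that] v0 by auto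
    then have "v + u \<in> verts G \<and> page_le (v + u) v"
      using inv[OF sq(1)] inv[OF sq(2)] inv[OF sq(3)] pages by (elim insertE) simp_all
    then show ?thesis by (simp add: add.commute Hgraph_def induced_subgraph_def)
  qed
  have "\<exists>s\<in>verts (Ugraph 2). \<exists>t\<in>verts (Ugraph 2). s \<noteq> t \<and> e = {s, t}" if "e \<in> edges (Ugraph 2)" for e
  proof -
    have "e \<in> edges square_lattice"
      using that by (auto simp: Ugraph_def Utilde_def induced_subgraph_def Uinf_simps)
    then obtain s t where st: "s \<noteq> t" "e = {s, t}" using lattice_edges_form by blast
    then have "adj (Ugraph 2) s t" using that by (simp add: adj_def)
    then show ?thesis using st by (auto simp: Ugraph_simps(2))
  qed
  then have "wf_ugraph (translate_graph v (Ugraph 2))"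
    unfolding wf_ugraph_def translate_graph_def map_ugraph_def by fastforce
  then show ?thesis
    using e w by (auto simp: subgraph_def translate_graph_def map_ugraph_def)
qed

text \<open>
  The bound on the growth of the number of spanning trees when \<open>v\<close> is added.
\<close>
definition step_factor :: "point ugraph \<Rightarrow> point \<Rightarrow> real" where
  "step_factor G v = (if depth G v \<ge> 2 then Fval (depth G v) else 1)"

lemma step_factor_ge_1: "step_factor G v \<ge> 1"
  using Fval_ge_1 by (simp add: step_factor_def)

text \<open>
  Deleting the left edge of \<open>v\<close> leaves the upper one as a bridge.  Hence the count can only grow if the left edge lies on
  a cycle of earlier vertices and \<open>v\<close>; then the square at \<open>v\<close> is present, so \<open>d\<^sub>v\<close> is a maximum over a set that contains 2.
\<close>
lemma add_vertex:
  assumes simple: "simple_grid_graph G" and v: "v \<in> verts G"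
  defines "W \<equiv> {u \<in> verts G. page_le u v}"
  shows "real (card (bases (edges_within G W)))
    \<le> step_factor G v * real (card (bases (edges_within G (W - {v}))))"
proof -
  obtain \<alpha> where G: "G = enclosed_graph \<alpha>" and grid: "grid_graph G"
    using simple by (auto simp: simple_grid_graph_def)
  have fin: "finite (verts G)" and wf: "wf_ugraph G" and lat: "edges G \<subseteq> edges square_lattice"
    using grid by (auto simp: grid_graph_def subgraph_def)
  have inv: "s \<in> verts G \<and> t \<in> verts G" if "{s, t} \<in> edges G" for s t
    using wf that unfolding wf_ugraph_def by (force simp: doubleton_eq_iff)
  have enclosed: "{s, t} \<in> edges G \<longleftrightarrow> {s, t} \<in> edges square_lattice
      \<and> closed_segment (plane s) (plane t) \<subseteq> loop_region \<alpha>" for s t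
    unfolding G enclosed_graph_def
    by (auto simp: adj_def doubleton_eq_iff closed_segment_commute insert_commute
        simp del: split_paired_Ex)
  define E where "E = edges_within G W"
  define E' where "E' = edges_within G (W - {v})"
  define e1 where "e1 = {v, v + (-1, 0)}"
  define e2 where "e2 = {v, v + (0, 1)}"
  have EG: "E \<subseteq> edges G" by (auto simp: E_def edges_within_def)
  have "finite E" by (rule finite_subset[of _ "Pow (verts G)"]) (use fin in \<open>auto simp: E_def edges_within_def W_def\<close>)
  then have E: "edge_set E" using EG lat lattice_edges_form unfolding edge_set_def by blast
  have E_H: "edges (Hgraph G v) = E"
    using wf by (auto simp: edges_Hgraph E_def edges_within_def W_def wf_ugraph_def)
  have EE': "E' \<subseteq> E" "e1 \<notin> E'" "e2 \<notin> E'"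
    by (auto simp: E_def E'_def e1_def e2_def edges_within_def)
  have new: "e = e1 \<or> e = e2" if "e \<in> E - E'" for e
  proof -
    have e: "e \<in> edges square_lattice" "e \<subseteq> W" "v \<in> e"
      using that EG lat by (auto simp: E_def E'_def edges_within_def)
    then obtain w where w: "e = {v, w}" using lattice_edges_form by blast
    then have "page_le w v" using e(2) by (auto simp: W_def)
    moreover have "w = v + (1, 0) \<or> w = v + (-1, 0) \<or> w = v + (0, 1) \<or> w = v + (0, -1)"
      using e(1) w by (intro lattice_edge_cases) simp
    ultimately have "w = v + (-1, 0) \<or> w = v + (0, 1)"
      by (elim disjE) (simp_all add: page_le_def)
    then show ?thesis unfolding w e1_def e2_def by blast
  qed
  have isolated: "v \<notin> \<Union>E'" by (auto simp: E'_def edges_within_def)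
  have vne: "v + (-1, 0) \<noteq> v" "v + (0, 1) \<noteq> v" by (cases v; simp)+
  have bridge1: "(v, v + (-1, 0)) \<notin> conn E'" and bridge2: "(v, v + (0, 1)) \<notin> conn E'"
    using conn_isolated[OF _ isolated] vne by blast+
  have le: "real n \<le> step_factor G v * real m" if "n \<le> m" for n m
    using mult_mono[of 1 "step_factor G v" "real n" "real m"] step_factor_ge_1[of G v] that by simp
  show ?thesis
    unfolding E_def[symmetric] E'_def[symmetric]
  proof (cases "e1 \<in> E")
    case False
    then have "E - {e2} = E'" using new EE' by blast
    then show "real (card (bases E)) \<le> step_factor G v * real (card (bases E'))"
      using card_bases_bridge[OF \<open>finite E\<close>, of v "v + (0, 1)"] bridge2 unfolding e2_def by (intro le) simp
  next
    case e1: True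
    show "real (card (bases E)) \<le> step_factor G v * real (card (bases E'))"
    proof (cases "(v, v + (-1, 0)) \<in> conn (E - {e1})")
      case False
      have "card (bases E) \<le> card (bases (E - {e1}))"
        using card_bases_bridge[OF \<open>finite E\<close>] False unfolding e1_def by blast
      also have "card (bases (E - {e1})) \<le> card (bases E')"
      proof -
        have "E - {e1} - {e2} = E'" using new EE' by blast
        then show ?thesis
          using card_bases_bridge[of "E - {e1}" v "v + (0, 1)"] bridge2 \<open>finite E\<close> unfolding e2_def by simp
      qed
      finally show ?thesis by (rule le)
    next
      case cyc: True
      have e2: "e2 \<in> E"
      proof (rule ccontr)
        assume "e2 \<notin> E"
        then have "E - {e1} = E'" using new EE' by blast
        then show False using cyc bridge1 by simp
      qed
      have "e1 \<noteq> e2" by (cases v) (simp add: e1_def e2_def doubleton_eq_iff)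
      then have del: "E - {e1} = insert e2 E'" "E - {e1} - {e2} = E'"
        using new EE' e2 by blast+
      \<comment> \<open>\<open>v\<close> is isolated in \<open>E'\<close>, so the bypass of \<open>e1\<close> starts with \<open>e2\<close>\<close>
      have con: "(v + (-1, 0), v + (0, 1)) \<in> conn E'"
      proof -
        have "(v, v + (-1, 0)) \<in> conn (insert {v, v + (0, 1)} E')"
          using cyc unfolding del(1) e2_def .
        then have "(v + (0, 1), v + (-1, 0)) \<in> conn E'"
          using conn_insert[of v "v + (-1, 0)" v "v + (0, 1)" E'] bridge1 bridge2 by argo
        then show ?thesis by (rule conn_symD)
      qed
      have e12: "{v, v + (-1, 0)} \<in> edges G" "{v, v + (0, 1)} \<in> edges G"
        using e1 e2 EG by (auto simp: e1_def e2_def)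
      have F: "E' \<subseteq> edges square_lattice" using EE' EG lat by blast
      have D: "drawing E' \<subseteq> loop_region \<alpha>"
        using EE'(1) EG enclosed unfolding drawing_def by blast
      have early: "page_le s v \<and> s \<noteq> v" if "s \<in> \<Union>E'" for s
        using that by (auto simp: E'_def edges_within_def W_def)
      have segs: "closed_segment (plane v) (plane (v + (-1, 0))) \<subseteq> loop_region \<alpha>"
        "closed_segment (plane v) (plane (v + (0, 1))) \<subseteq> loop_region \<alpha>"
        using e12 enclosed by blast+
      note sq = square_enclosed[OF F D early con segs]
      have "{v + (-1, 0), v + (-1, 1)} \<in> edges square_lattice" "{v + (0, 1), v + (-1, 1)} \<in> edges square_lattice"
        by (simp_all add: lattice_edge)
      then have "{v + (-1, 0), v + (-1, 1)} \<in> edges G" "{v + (0, 1), v + (-1, 1)} \<in> edges G"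
        using sq enclosed by blast+
      then have "subgraph (translate_graph v (Ugraph 2)) (Hgraph G v)"
        using e12 by (intro square_subgraph wf)
      then have two: "2 \<in> {k. k \<ge> 1 \<and> subgraph (translate_graph v (Ugraph k)) (Hgraph G v)}" by simp
      have d2: "depth G v \<ge> 2"
        unfolding depth_def by (rule Max_ge[OF finite_depths[OF fin] two])
      have "depth G v \<in> {k. k \<ge> 1 \<and> subgraph (translate_graph v (Ugraph k)) (Hgraph G v)}"
        unfolding depth_def by (rule Max_in[OF finite_depths[OF fin]]) (use two in blast)
      then have "edges (translate_graph v (Ugraph (depth G v))) \<subseteq> E"
        by (simp add: subgraph_def E_H)
      then have sub: "(\<lambda>u. u + v) ` e \<in> E" if "e \<in> edges (Ugraph (depth G v))" for e
        using that by (auto simp: translate_graph_def map_ugraph_def)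
      have "real (card (bases E)) \<le> step_factor G v * real (card (bases (E - {e1})))"
        using Fval_bound[OF d2 E sub] d2 by (simp add: step_factor_def e1_def)
      also have "card (bases (E - {e1})) \<le> card (bases E')"
        using card_bases_bridge[of "E - {e1}" v "v + (0, 1)"] bridge2 \<open>finite E\<close> del(2)
        unfolding e2_def by simp
      then have "step_factor G v * real (card (bases (E - {e1}))) \<le> step_factor G v * real (card (bases E'))"
        using step_factor_ge_1[of G v] by (intro mult_left_mono) auto
      finally show ?thesis .
    qed
  qed
qed

lemma card_bases_initial:
  assumes simple: "simple_grid_graph G"
  shows "W \<subseteq> verts G \<Longrightarrow> (\<And>u w. w \<in> W \<Longrightarrow> u \<in> verts G \<Longrightarrow> page_le u w \<Longrightarrow> u \<in> W) \<Longrightarrow>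
    real (card (bases (edges_within G W))) \<le> (\<Prod>v\<in>W. step_factor G v)"
proof (induction "card W" arbitrary: W)
  have fin: "finite (verts G)" and wf: "wf_ugraph G"
    using simple by (auto simp: simple_grid_graph_def grid_graph_def subgraph_def)
  {
    case 0
    then have "W = {}" using finite_subset[OF _ fin] by auto
    then have "edges_within G W = {}" using wf by (auto simp: edges_within_def wf_ugraph_def)
    then have "bases (edges_within G W) \<subseteq> {{}}" by (auto simp: bases_def)
    then have "card (bases (edges_within G W)) \<le> card {{} :: point set set}" by (intro card_mono) auto
    then show ?case using \<open>W = {}\<close> by simp
  next
    case (Suc n)
    have finW: "finite W" using finite_subset[OF Suc.prems(1) fin] .
    have "W \<noteq> {}" using Suc.hyps(2) by auto
    then obtain v where v: "v \<in> W" "\<And>u. u \<in> W \<Longrightarrow> page_le u v"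
      using page_last[OF finW] by metis
    have W: "W = {u \<in> verts G. page_le u v}" using v Suc.prems by blast
    have "real (card (bases (edges_within G (W - {v})))) \<le> (\<Prod>v\<in>W - {v}. step_factor G v)"
    proof (rule Suc.hyps(1))
      show "n = card (W - {v})" using Suc.hyps(2) v(1) finW by simp
      show "W - {v} \<subseteq> verts G" using Suc.prems(1) by blast
      show "u \<in> W - {v}" if "w \<in> W - {v}" "u \<in> verts G" "page_le u w" for u w
        using that Suc.prems(2)[of w u] v(2)[of w] page_le_antisym[of w v] by auto
    qed
    moreover have "v \<in> verts G" using v(1) Suc.prems(1) by blast
    ultimately have "real (card (bases (edges_within G W)))
        \<le> step_factor G v * (\<Prod>v\<in>W - {v}. step_factor G v)"
      using add_vertex[OF simple, of v] step_factor_ge_1[of G v] unfolding W[symmetric]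
      by (meson mult_left_mono order_trans zero_le_one)
    then show ?case using prod.remove[OF finW v(1), of "step_factor G"] by simp
  }
qed

theorem mainTheorem5:
  fixes G :: "point ugraph"
  assumes "simple_grid_graph G"
  shows "ln (real (num_spanning_trees G)) \<le> (\<Sum>\<^sub>\<infinity>k\<in>{2..}. ln (Fval k) * real (card (depth_class G k)))"
proof -
  have fin: "finite (verts G)" and wf: "wf_ugraph G"
    using assms by (auto simp: simple_grid_graph_def grid_graph_def subgraph_def)
  have all: "edges_within G (verts G) = edges G"
    using wf by (auto simp: edges_within_def wf_ugraph_def)
  have finE: "finite (edges G)"
    unfolding all[symmetric] using fin by (auto simp: edges_within_def intro: finite_subset[of _ "Pow (verts G)"])
  define D where "D = {v \<in> verts G. depth G v \<ge> 2}"
  have "real (num_spanning_trees G) \<le> real (card (bases (edges G)))"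
    using num_spanning_trees_le[OF wf finE] by simp
  also have "\<dots> \<le> (\<Prod>v\<in>verts G. step_factor G v)"
    using card_bases_initial[OF assms, of "verts G"] all by simp
  finally have le: "real (num_spanning_trees G) \<le> (\<Prod>v\<in>verts G. step_factor G v)" .
  have pos: "step_factor G v > 0" for v using step_factor_ge_1[of G v] by linarith
  have nonneg: "ln (step_factor G v) \<ge> 0" for v using step_factor_ge_1 by simp
  have "ln (real (num_spanning_trees G)) \<le> (\<Sum>v\<in>verts G. ln (step_factor G v))"
  proof (cases "num_spanning_trees G = 0")
    case True
    then show ?thesis using nonneg by (simp add: sum_nonneg)
  next
    case False
    then have "ln (real (num_spanning_trees G)) \<le> ln (\<Prod>v\<in>verts G. step_factor G v)"
      using le by (intro ln_mono) auto
    also have "\<dots> = (\<Sum>v\<in>verts G. ln (step_factor G v))"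
      by (intro ln_prod less_imp_neq[symmetric] pos fin)
    finally show ?thesis .
  qed
  also have "\<dots> = (\<Sum>v\<in>D. ln (Fval (depth G v)))"
    using fin by (intro sum.mono_neutral_cong_right) (auto simp: D_def step_factor_def)
  also have "\<dots> = (\<Sum>k\<in>depth G ` D. \<Sum>v\<in>{v \<in> D. depth G v = k}. ln (Fval (depth G v)))"
    using fin by (intro sum.group[symmetric]) (auto simp: D_def)
  also have "\<dots> = (\<Sum>k\<in>depth G ` D. ln (Fval k) * real (card (depth_class G k)))"
  proof (intro sum.cong refl)
    fix k assume "k \<in> depth G ` D"
    then have "{v \<in> D. depth G v = k} = depth_class G k" by (auto simp: D_def depth_class_def)
    moreover have "(\<Sum>v\<in>{v \<in> D. depth G v = k}. ln (Fval (depth G v))) = (\<Sum>v\<in>{v \<in> D. depth G v = k}. ln (Fval k))"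
      by (intro sum.cong) auto
    ultimately show "(\<Sum>v\<in>{v \<in> D. depth G v = k}. ln (Fval (depth G v))) = ln (Fval k) * real (card (depth_class G k))"
      by simp
  qed
  also have "\<dots> = (\<Sum>\<^sub>\<infinity>k\<in>depth G ` D. ln (Fval k) * real (card (depth_class G k)))"
    using fin by (intro infsum_finite[symmetric]) (simp add: D_def)
  also have "\<dots> = (\<Sum>\<^sub>\<infinity>k\<in>{2..}. ln (Fval k) * real (card (depth_class G k)))"
  proof (rule infsum_cong_neutral)
    fix k assume "k \<in> {2..} - depth G ` D"
    then have "depth_class G k = {}" by (auto simp: D_def depth_class_def)
    then show "ln (Fval k) * real (card (depth_class G k)) = 0" by simp
  qed (auto simp: D_def)
  finally show ?thesis .
qed

end
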